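(* The Weighted Efficient Domination problem is solvable in polynomial time on $S_{1,2,3}$-free chordal graphs.
   Context: A graph is chordal if it contains no induced cycle $C_k$ with $k\ge 4$. $S_{1,2,3}$ is the tree consisting of a vertex $u$ with three pendant induced paths attached at $u$ having $1$, $2$ and $3$ further vertices respectively (a subdivided claw with branch lengths 1, 2, 3). $H$-free means no induced subgraph isomorphic to $H$. A set $D\subseteq V$ is an efficient dominating set (e.d.s.) of $G=(V,E)$ if $|D\cap N[v]|=1$ for every $v\in V$, where $N[v]$ is the closed neighborhood. Weighted Efficient Domination (WED): given $G=(V,E)$ with vertex weights $\omega: V\to\mathbb{N}\cup\{\infty\}$, find an e.d.s. of minimum finite total weight, or determine that no e.d.s. of finite weight exists. *)

theory Defs
  imports
    Complex_Main
    "HOL-Library.Extended_Nat"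
    "HOL-Library.Log_Nat"
    "HOL-Computational_Algebra.Polynomial"
begin

section \<open>Graphs\<close>

record 'a ugraph =
  verts :: "'a set"
  edges :: "'a set set"

definition simple_graph :: "'a ugraph \<Rightarrow> bool" where
  "simple_graph G \<longleftrightarrow> finite (verts G) \<and> (\<forall>e\<in>edges G. e \<subseteq> verts G \<and> card e = 2)"

definition has_induced_copy :: "'b ugraph \<Rightarrow> 'a ugraph \<Rightarrow> bool" where
  "has_induced_copy H G \<longleftrightarrow>
     (\<exists>f. inj_on f (verts H) \<and> f ` verts H \<subseteq> verts G \<and>
          (\<forall>x\<in>verts H. \<forall>y\<in>verts H. {f x, f y} \<in> edges G \<longleftrightarrow> {x, y} \<in> edges H))"

definition induced_free :: "'b ugraph \<Rightarrow> 'a ugraph \<Rightarrow> bool" where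
  "induced_free H G \<longleftrightarrow> \<not> has_induced_copy H G"

definition cycle_graph :: "nat \<Rightarrow> nat ugraph" where
  "cycle_graph k = \<lparr>verts = {..<k}, edges = {{i, (i + 1) mod k} |i. i < k}\<rparr>"

definition chordal :: "'a ugraph \<Rightarrow> bool" where
  "chordal G \<longleftrightarrow> (\<forall>k\<ge>4. induced_free (cycle_graph k) G)"

text \<open>The centre is 0; the branches are 1, then 2, 3, and then 4, 5, 6.\<close>

definition S123 :: "nat ugraph" where
  "S123 = \<lparr>verts = {..6}, edges = {{0, 1}, {0, 2}, {2, 3}, {0, 4}, {4, 5}, {5, 6}}\<rparr>"


section \<open>Weighted efficient domination\<close>

definition closed_nbhd :: "'a ugraph \<Rightarrow> 'a \<Rightarrow> 'a set" where
  "closed_nbhd G v = {u \<in> verts G. u = v \<or> {u, v} \<in> edges G}"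

definition eds :: "'a ugraph \<Rightarrow> 'a set \<Rightarrow> bool" where
  "eds G D \<longleftrightarrow> D \<subseteq> verts G \<and> (\<forall>v\<in>verts G. card (D \<inter> closed_nbhd G v) = 1)"

definition min_finite_eds :: "'a ugraph \<Rightarrow> ('a \<Rightarrow> enat) \<Rightarrow> 'a set \<Rightarrow> bool" where
  "min_finite_eds G \<omega> D \<longleftrightarrow>
     eds G D \<and> sum \<omega> D \<noteq> \<infinity> \<and> (\<forall>D'. eds G D' \<longrightarrow> sum \<omega> D \<le> sum \<omega> D')"


section \<open>Random access machine programs and polynomial time\<close>

text \<open>
  Structured programs for a random access machine. The store maps each array name to an
  unbounded array of natural numbers; a scalar variable is cell 0 of its array. The arithmetic
  operations are addition and truncated subtraction only, so a step lengthens the largest number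
  by a number of bits that depends on the program alone. This is what makes the unit cost
  measure below polynomially equivalent to Turing machine time (it would not be with
  multiplication). Expressions are evaluated at no separate cost, which changes running times
  only by a constant factor that depends on the program.
\<close>

type_synonym store = "string \<Rightarrow> nat \<Rightarrow> nat"

datatype aexp = Const nat | Cell string aexp | Plus aexp aexp | Minus aexp aexp

datatype bexp = Less aexp aexp | Not bexp | And bexp bexp

datatype com =
    Skip
  | Assign string aexp aexp
  | Seq com com
  | If bexp com com
  | While bexp com

fun aval :: "aexp \<Rightarrow> store \<Rightarrow> nat" where
  "aval (Const n) s = n"
| "aval (Cell x a) s = s x (aval a s)"
| "aval (Plus a b) s = aval a s + aval b s"
| "aval (Minus a b) s = aval a s - aval b s"

fun bval :: "bexp \<Rightarrow> store \<Rightarrow> bool" where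
  "bval (Less a b) s \<longleftrightarrow> aval a s < aval b s"
| "bval (Not b) s \<longleftrightarrow> \<not> bval b s"
| "bval (And b c) s \<longleftrightarrow> bval b s \<and> bval c s"

text \<open>
  \<open>exec c s t s'\<close>: started in store \<open>s\<close>, the program \<open>c\<close> halts after \<open>t\<close> steps in store \<open>s'\<close>.
  The command \<open>Assign x a b\<close> stores the value of \<open>b\<close> in cell \<open>a\<close> of array \<open>x\<close>.
\<close>

inductive exec :: "com \<Rightarrow> store \<Rightarrow> nat \<Rightarrow> store \<Rightarrow> bool" where
  Skip: "exec Skip s 1 s"
| Assign: "exec (Assign x a b) s 1 (s(x := (s x)(aval a s := aval b s)))"
| Seq: "exec c\<^sub>1 s t\<^sub>1 s' \<Longrightarrow> exec c\<^sub>2 s' t\<^sub>2 s'' \<Longrightarrow> exec (Seq c\<^sub>1 c\<^sub>2) s (t\<^sub>1 + t\<^sub>2) s''"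
| IfTrue: "bval b s \<Longrightarrow> exec c\<^sub>1 s t s' \<Longrightarrow> exec (If b c\<^sub>1 c\<^sub>2) s (1 + t) s'"
| IfFalse: "\<not> bval b s \<Longrightarrow> exec c\<^sub>2 s t s' \<Longrightarrow> exec (If b c\<^sub>1 c\<^sub>2) s (1 + t) s'"
| WhileFalse: "\<not> bval b s \<Longrightarrow> exec (While b c) s 1 s"
| WhileTrue: "bval b s \<Longrightarrow> exec c s t\<^sub>1 s' \<Longrightarrow> exec (While b c) s' t\<^sub>2 s'' \<Longrightarrow>
    exec (While b c) s (1 + t\<^sub>1 + t\<^sub>2) s''"

inductive_cases SkipE: "exec Skip s t s'"
  and AssignE: "exec (Assign x a b) s t s'"
  and SeqE: "exec (Seq c\<^sub>1 c\<^sub>2) s t s'"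
  and IfE: "exec (If b c\<^sub>1 c\<^sub>2) s t s'"
  and WhileE: "exec (While b c) s t s'"

text \<open>
  Execution is deterministic, so the existential quantifiers over the running time and the final
  store in the definition of \<open>poly_time_solvable\<close> leave no choice.
\<close>

lemma exec_deterministic:
  "exec c s t s' \<Longrightarrow> exec c s u s'' \<Longrightarrow> u = t \<and> s'' = s'"
proof (induction arbitrary: u s'' rule: exec.induct)
  case (Skip s)
  then show ?case by (auto elim: SkipE)
next
  case (Assign x a b s)
  then show ?case by (auto elim: AssignE)
next
  case (Seq c\<^sub>1 s t\<^sub>1 s' c\<^sub>2 t\<^sub>2 s2)
  from Seq.prems obtain u\<^sub>1 u\<^sub>2 r where *: "exec c\<^sub>1 s u\<^sub>1 r" "exec c\<^sub>2 r u\<^sub>2 s''" "u = u\<^sub>1 + u\<^sub>2"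
    by (rule SeqE)
  have r: "u\<^sub>1 = t\<^sub>1 \<and> r = s'"
    using *(1) by (rule Seq.IH(1))
  have "u\<^sub>2 = t\<^sub>2 \<and> s'' = s2"
    using *(2) r by (intro Seq.IH(2)) simp
  with r *(3) show ?case by simp
next
  case (IfTrue b s c\<^sub>1 t s' c\<^sub>2)
  from IfTrue.prems IfTrue.hyps(1) obtain u' where *: "exec c\<^sub>1 s u' s''" "u = 1 + u'"
    by (auto elim: IfE)
  from IfTrue.IH[OF *(1)] *(2) show ?case by simp
next
  case (IfFalse b s c\<^sub>2 t s' c\<^sub>1)
  from IfFalse.prems IfFalse.hyps(1) obtain u' where *: "exec c\<^sub>2 s u' s''" "u = 1 + u'"
    by (auto elim: IfE)
  from IfFalse.IH[OF *(1)] *(2) show ?case by simp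
next
  case (WhileFalse b s c)
  from WhileFalse.prems show ?case
    by (rule WhileE) (use WhileFalse.hyps in simp_all)
next
  case (WhileTrue b s c t\<^sub>1 s' t\<^sub>2 s2)
  from WhileTrue.prems obtain u\<^sub>1 u\<^sub>2 r
    where *: "exec c s u\<^sub>1 r" "exec (While b c) r u\<^sub>2 s''" "u = 1 + u\<^sub>1 + u\<^sub>2"
    by (rule WhileE) (use WhileTrue.hyps(1) in simp_all)
  have r: "u\<^sub>1 = t\<^sub>1 \<and> r = s'"
    using *(1) by (rule WhileTrue.IH(1))
  have "u\<^sub>2 = t\<^sub>2 \<and> s'' = s2"
    using *(2) r by (intro WhileTrue.IH(2)) simp
  with r *(3) show ?case by simp
qed

text \<open>
  A search problem on a set of instances: one fixed program, started in the store encoding an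
  instance, halts within a number of steps polynomial in the size of the instance, in a store
  that represents a correct answer.
\<close>

definition poly_time_solvable ::
    "'i set \<Rightarrow> ('i \<Rightarrow> store) \<Rightarrow> ('i \<Rightarrow> nat) \<Rightarrow> ('i \<Rightarrow> store \<Rightarrow> bool) \<Rightarrow> bool" where
  "poly_time_solvable I input isize answer \<longleftrightarrow>
     (\<exists>(c :: com) (p :: nat poly). \<forall>x\<in>I. \<exists>t s'.
        exec c (input x) t s' \<and> t \<le> poly p (isize x) \<and> answer x s')"


section \<open>Weighted efficient domination as a computational problem\<close>

text \<open>
  Inputs are graphs with vertex set \<open>{0, \<dots>, n - 1}\<close>, given by \<open>n\<close>, the adjacency matrix in row-major
  order, and the weights. The weight \<open>\<infinity>\<close> is represented by 0 and the weight \<open>k\<close> by \<open>k + 1\<close>. All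
  other cells are initially 0.
\<close>

type_synonym wed_instance = "nat ugraph \<times> (nat \<Rightarrow> enat)"

definition wed_instances :: "(nat ugraph \<Rightarrow> bool) \<Rightarrow> wed_instance set" where
  "wed_instances P = {(G, \<omega>). simple_graph G \<and> (\<exists>n. verts G = {..<n}) \<and> P G}"

definition weight_code :: "enat \<Rightarrow> nat" where
  "weight_code w = (case w of enat k \<Rightarrow> Suc k | \<infinity> \<Rightarrow> 0)"

definition wed_input :: "wed_instance \<Rightarrow> store" where
  "wed_input = (\<lambda>(G, \<omega>) x i. let n = card (verts G) in
     if x = ''n'' \<and> i = 0 then n
     else if x = ''adj'' \<and> i < n * n \<and> {i div n, i mod n} \<in> edges G then 1
     else if x = ''weight'' \<and> i < n then weight_code (\<omega> i)
     else 0)"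

text \<open>The size of an instance is the number of bits of the adjacency matrix and the weights.\<close>

definition wed_size :: "wed_instance \<Rightarrow> nat" where
  "wed_size = (\<lambda>(G, \<omega>). let n = card (verts G) in
     n * n + (\<Sum>v<n. floorlog 2 (weight_code (\<omega> v))))"

text \<open>
  The output is \<open>found\<close>, which is 0 if and only if there is no e.d.s. of finite weight, and
  otherwise the characteristic vector \<open>D\<close> of an e.d.s. of minimum finite weight.
\<close>

definition wed_answer :: "wed_instance \<Rightarrow> store \<Rightarrow> bool" where
  "wed_answer = (\<lambda>(G, \<omega>) s.
     if \<exists>D. eds G D \<and> sum \<omega> D \<noteq> \<infinity>
     then s ''found'' 0 = 1 \<and> min_finite_eds G \<omega> {v \<in> verts G. s ''D'' v = 1}
     else s ''found'' 0 = 0)"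

definition WED_poly_time_on :: "(nat ugraph \<Rightarrow> bool) \<Rightarrow> bool" where
  "WED_poly_time_on P \<longleftrightarrow>
     poly_time_solvable (wed_instances P) wed_input wed_size wed_answer"

end

theory Submission
  imports Defs
begin

text \<open>
  An e.d.s. is a set of vertices whose closed neighbourhoods partition the vertex set. Call two
  vertices near if their closed neighbourhoods intersect, i.e. if they are adjacent or equal in the
  square of the graph. With the value of \<open>v\<close> set to \<open>|N[v]| * B - \<omega>(v)\<close> for a large \<open>B\<close>, an e.d.s. of
  minimum weight is an independent set of maximum value in the square, and this can be found by
  local ratio steps at simplicial vertices as long as the square is chordal.

  The square need not be chordal, but it has no hole among the admissible vertices \<open>v\<close>, those for
  which every vertex \<open>u\<close> has some \<open>w\<close> in \<open>N[u]\<close> that is equal or not near to \<open>v\<close>. Let \<open>D\<close> be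
  an e.d.s. and suppose there is such a hole. Choose midpoints \<open>m\<^sub>i\<close> of its consecutive vertices
  \<open>s\<^sub>i\<close>, \<open>s\<^bsub>i+1\<^esub>\<close>, in \<open>D\<close> if possible. Chordality makes the \<open>s\<^sub>i\<close> independent and the \<open>m\<^sub>i\<close> a cycle,
  so two midpoints \<open>x\<close>, \<open>y\<close> that are not consecutive are adjacent. Each of them has two private
  neighbours on the hole. If neither of \<open>x\<close>, \<open>y\<close> is in \<open>D\<close>, then on either side one of the two has a
  dominator not adjacent to its midpoint, which gives an induced \<open>S\<^bsub>1,2,3\<^esub>\<close> with centre \<open>x\<close>. If,
  say, \<open>x\<close> is in \<open>D\<close>, then the admissibility of one of its two neighbours provides the missing end
  of such a subgraph.
\<close>


section \<open>Holes and simplicial vertices\<close>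

text \<open>If the midpoint of two consecutive hole vertices is not in \<open>D\<close>, then by the
  way midpoints are chosen no member of \<open>D\<close> dominates both vertices, so their
  dominators are distinct. Distinct members of \<open>D\<close> have disjoint closed neighbourhoods,
  hence the midpoint lies in the closed neighbourhood of at most one of the two dominators. The
  branches of the \<open>S123\<close> at \<open>x\<close> are then one private neighbour of
  \<open>x\<close>, the other one followed by its dominator, and \<open>y\<close> followed by a
  private neighbour of \<open>y\<close> and its dominator. The program does not know
  \<open>D\<close>. Admissibility is therefore a test that can be evaluated without \<open>D\<close>
  and still keeps every member of every e.d.s. Hole-freeness, in contrast, is derived from the
  existence of some e.d.s., which the program cannot presuppose; it runs the same phases on every
  input and verifies the candidate at the end. The value \<open>|N[v]| * B\<close> is additive on
  sets without near pairs because their closed neighbourhoods are disjoint: it counts dominated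
  vertices, and equality with the number of all vertices characterizes an e.d.s.\<close>

definition hole :: "('a \<Rightarrow> 'a \<Rightarrow> bool) \<Rightarrow> 'a set \<Rightarrow> nat \<Rightarrow> (nat \<Rightarrow> 'a) \<Rightarrow> bool" where
  "hole R X k f \<longleftrightarrow> 4 \<le> k \<and> inj_on f {..<k} \<and> f ` {..<k} \<subseteq> X \<and>
     (\<forall>i<k. \<forall>j<k. R (f i) (f j) \<longleftrightarrow> j = Suc i mod k \<or> i = Suc j mod k)"

definition hole_free :: "('a \<Rightarrow> 'a \<Rightarrow> bool) \<Rightarrow> 'a set \<Rightarrow> bool" where
  "hole_free R X \<longleftrightarrow> (\<forall>k f. \<not> hole R X k f)"

abbreviation walk_in :: "('a \<Rightarrow> 'a \<Rightarrow> bool) \<Rightarrow> 'a set \<Rightarrow> 'a \<Rightarrow> 'a \<Rightarrow> bool" where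
  "walk_in R Z \<equiv> (\<lambda>u v. R u v \<and> u \<in> Z \<and> v \<in> Z)\<^sup>*\<^sup>*"

lemma hole_free_mono: "hole_free R X \<Longrightarrow> Y \<subseteq> X \<Longrightarrow> hole_free R Y"
  unfolding hole_free_def hole_def by (meson subset_trans)

lemma shortest_walk:
  assumes "P\<^sup>*\<^sup>* s t"
  obtains n f where "f 0 = s" "f n = t" "\<And>i. i < n \<Longrightarrow> P (f i) (f (Suc i))"
    "\<And>i j. i < j \<Longrightarrow> j \<le> n \<Longrightarrow> f i \<noteq> f j"
    "\<And>i j. i < j \<Longrightarrow> j \<le> n \<Longrightarrow> P (f i) (f j) \<Longrightarrow> j = Suc i"
proof -
  define n where "n = (LEAST n. (P ^^ n) s t)"
  have ex: "\<exists>n. (P ^^ n) s t" using assms by (simp add: rtranclp_power)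
  have n: "(P ^^ n) s t" unfolding n_def using ex by (rule LeastI_ex)
  have least: "n \<le> m" if "(P ^^ m) s t" for m
    unfolding n_def using that by (rule Least_le)
  from n obtain f where f: "f 0 = s" "f n = t" "\<And>i. i < n \<Longrightarrow> P (f i) (f (Suc i))"
    by (auto simp: relpowp_fun_conv)
  have pre: "(P ^^ i) s (f i)" if "i \<le> n" for i
    unfolding relpowp_fun_conv using that f by (intro exI[of _ f]) auto
  have post: "(P ^^ (n - j)) (f j) t" if "j \<le> n" for j
    unfolding relpowp_fun_conv using that f by (intro exI[of _ "\<lambda>i. f (j + i)"]) auto
  show thesis
  proof (rule that[OF f])
    fix i j assume ij: "i < j" "j \<le> n"
    show "f i \<noteq> f j"
    proof
      assume "f i = f j"
      then have "(P ^^ (i + (n - j))) s t"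
        unfolding relpowp_add using pre[of i] post[of j] ij by auto
      from least[OF this] ij show False by simp
    qed
    assume "P (f i) (f j)"
    then have "(P ^^ (Suc i + (n - j))) s t"
      unfolding relpowp_add using pre[of i] post[of j] ij by auto
    from least[OF this] ij show "j = Suc i" by simp
  qed
qed

text \<open>A shortest walk from \<open>s\<close> to \<open>t\<close> in \<open>Z\<close> is
  induced, and \<open>a\<close> sees only its two ends, so without the edge \<open>s t\<close> the
  vertex \<open>a\<close> would close it to a hole. This is the form in which the absence of holes
  is used below, both for the graph and for its square.\<close>

lemma chord_closed:
  assumes free: "hole_free R X" and sym: "symp R" and irr: "irreflp R"
    and X: "a \<in> X" "Z \<subseteq> X" and a: "a \<notin> Z" "R a s" "R a t" "s \<in> Z" "t \<in> Z" "s \<noteq> t"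
    and nbs: "\<And>z. z \<in> Z \<Longrightarrow> R a z \<Longrightarrow> z = s \<or> z = t"
    and walk: "walk_in R Z s t"
  shows "R s t"
proof (rule ccontr)
  assume nR: "\<not> R s t"
  have symR: "R u v \<longleftrightarrow> R v u" for u v using sym by (auto dest: sympD)
  obtain n f where f: "f 0 = s" "f n = t" "\<And>i. i < n \<Longrightarrow> R (f i) (f (Suc i)) \<and> f i \<in> Z \<and> f (Suc i) \<in> Z"
    and inj: "\<And>i j. i < j \<Longrightarrow> j \<le> n \<Longrightarrow> f i \<noteq> f j"
    and ind: "\<And>i j. i < j \<Longrightarrow> j \<le> n \<Longrightarrow> R (f i) (f j) \<and> f i \<in> Z \<and> f j \<in> Z \<Longrightarrow> j = Suc i"
    by (rule shortest_walk[OF walk]) blast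
  have fZ: "f i \<in> Z" if "i \<le> n" for i
  proof (cases i)
    case 0 then show ?thesis using f(1) a by simp
  next
    case (Suc j) then show ?thesis using f(3)[of j] that by simp
  qed
  have "n \<noteq> 0" using f(1,2) a(6) by metis
  moreover have "n \<noteq> 1" using f(1,2) f(3)[of 0] nR by auto
  ultimately have n2: "2 \<le> n" by simp
  \<comment> \<open>The vertex \<open>a\<close> gets index \<open>Suc n\<close>, so the cycle has
    length \<open>n + 2\<close>; this is at least 4 because \<open>s\<close> and \<open>t\<close>
    are distinct and not adjacent.\<close>
  define g where "g i = (if i \<le> n then f i else a)" for i
  have consec: "R (f i) (f j) \<longleftrightarrow> j = Suc i \<or> i = Suc j" if "i \<le> n" "j \<le> n" for i j
  proof -
    consider "i < j" | "i = j" | "j < i" by linarith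
    then show ?thesis
    proof cases
      case 1
      with that ind[of i j] f(3)[of i] fZ show ?thesis by auto
    next
      case 2
      then show ?thesis using irr by (auto dest: irreflpD)
    next
      case 3
      with that ind[of j i] f(3)[of j] fZ show ?thesis by (auto simp: symR[of "f i" "f j"])
    qed
  qed
  have Ra: "R a (f i) \<longleftrightarrow> i = 0 \<or> i = n" if "i \<le> n" for i
  proof
    assume "R a (f i)"
    then have "f i = f 0 \<or> f i = f n" using nbs[OF fZ[OF that]] f(1,2) by simp
    moreover have "f i \<noteq> f 0" if "i \<noteq> 0" using inj[of 0 i] that \<open>i \<le> n\<close> by force
    moreover have "f i \<noteq> f n" if "i \<noteq> n" using inj[of i n] that \<open>i \<le> n\<close> by force
    ultimately show "i = 0 \<or> i = n" by blast
  qed (use a(2,3) f(1,2) in auto)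
  have "hole R X (n + 2) g"
    unfolding hole_def
  proof (intro conjI allI impI)
    show "4 \<le> n + 2" using n2 by simp
    show "inj_on g {..<n + 2}"
    proof (rule linorder_inj_onI)
      fix i j assume "i < j" "i \<in> {..<n + 2}" "j \<in> {..<n + 2}"
      then show "g i \<noteq> g j"
        using inj[of i j] fZ[of i] a(1) by (auto simp: g_def)
    qed auto
    show "g ` {..<n + 2} \<subseteq> X" using fZ X by (auto simp: g_def)
    fix i j assume ij: "i < n + 2" "j < n + 2"
    have md: "Suc i mod (n + 2) = (if i = Suc n then 0 else Suc i)" if "i < n + 2" for i
      using that by auto
    have last: "i = Suc n" if "\<not> i \<le> n" "i < n + 2" for i using that by simp
    show "R (g i) (g j) \<longleftrightarrow> j = Suc i mod (n + 2) \<or> i = Suc j mod (n + 2)"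
      unfolding md[OF ij(1)] md[OF ij(2)]
    proof (cases "i \<le> n"; cases "j \<le> n")
      assume "i \<le> n" "j \<le> n"
      then show "R (g i) (g j) \<longleftrightarrow> j = (if i = Suc n then 0 else Suc i) \<or> i = (if j = Suc n then 0 else Suc j)" using consec[of i j] by (simp add: g_def)
    next
      assume "i \<le> n" "\<not> j \<le> n"
      then show "R (g i) (g j) \<longleftrightarrow> j = (if i = Suc n then 0 else Suc i) \<or> i = (if j = Suc n then 0 else Suc j)" using Ra[of i] last[of j] ij n2 by (auto simp: g_def symR[of _ a])
    next
      assume "\<not> i \<le> n" "j \<le> n"
      then show "R (g i) (g j) \<longleftrightarrow> j = (if i = Suc n then 0 else Suc i) \<or> i = (if j = Suc n then 0 else Suc j)" using Ra[of j] last[of i] ij n2 by (auto simp: g_def)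
    next
      assume "\<not> i \<le> n" "\<not> j \<le> n"
      then show "R (g i) (g j) \<longleftrightarrow> j = (if i = Suc n then 0 else Suc i) \<or> i = (if j = Suc n then 0 else Suc j)" using last[of i] last[of j] ij irr n2 by (auto simp: g_def dest: irreflpD)
    qed
  qed
  then show False using free by (simp add: hole_free_def)
qed

definition simplicial :: "('a \<Rightarrow> 'a \<Rightarrow> bool) \<Rightarrow> 'a set \<Rightarrow> 'a \<Rightarrow> bool" where
  "simplicial R X b \<longleftrightarrow> (\<forall>y\<in>X. \<forall>z\<in>X. R b y \<longrightarrow> R b z \<longrightarrow> y \<noteq> z \<longrightarrow> R y z)"

lemma walk_in_mono: "walk_in R Y u v \<Longrightarrow> Y \<subseteq> Z \<Longrightarrow> walk_in R Z u v"
  by (erule rtranclp_mono[THEN predicate2D, rotated]) auto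

lemma walk_in_sym: "symp R \<Longrightarrow> walk_in R Y u v \<Longrightarrow> walk_in R Y v u"
  using symp_rtranclp[of "\<lambda>u v. R u v \<and> u \<in> Y \<and> v \<in> Y"]
  by (auto simp: symp_def)

lemma walk_in_end: "walk_in R Y u v \<Longrightarrow> u \<in> Y \<Longrightarrow> v \<in> Y"
  by (induction rule: rtranclp_induct) auto

text \<open>Dirac's argument: a component \<open>C\<close> of the non-neighbours of \<open>a\<close> is attached to a clique.\<close>

lemma simplicial_non_neighbour:
  assumes "finite X" "hole_free R X" "symp R" "irreflp R"
    and "a \<in> X" "\<exists>b\<in>X. b \<noteq> a \<and> \<not> R a b"
  shows "\<exists>b\<in>X. b \<noteq> a \<and> \<not> R a b \<and> simplicial R X b"
  using assms
proof (induction X arbitrary: a rule: finite_psubset_induct)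
  case (psubset X)
  note sym = \<open>symp R\<close> and irr = \<open>irreflp R\<close>
  have symR: "R u v \<longleftrightarrow> R v u" for u v using sym by (auto dest: sympD)
  define Y where "Y = {b \<in> X. b \<noteq> a \<and> \<not> R a b}"
  obtain c where c: "c \<in> Y" using psubset.prems(5) unfolding Y_def by blast
  define C where "C = {b. walk_in R Y c b}"
  define S where "S = {s \<in> X. R a s \<and> (\<exists>b\<in>C. R s b)}"
  have CY: "C \<subseteq> Y"
  proof
    fix b assume "b \<in> C"
    then show "b \<in> Y" using walk_in_end[of R Y c b] c by (simp add: C_def)
  qed
  have cC: "c \<in> C" by (simp add: C_def)
  have step: "v \<in> C" if "u \<in> C" "R u v" "v \<in> Y" for u v
  proof -
    have "u \<in> Y" using that CY by auto
    then show ?thesis using that by (auto simp: C_def intro: rtranclp.rtrancl_into_rtrancl)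
  qed
  have nbC: "v \<in> C \<union> S" if "u \<in> C" "R u v" "v \<in> X" for u v
  proof (cases "v \<in> Y")
    case True with step that show ?thesis by blast
  next
    case False
    then show ?thesis using that CY by (auto simp: Y_def S_def symR)
  qed
  have inC: "walk_in R C u v" if "u \<in> C" "v \<in> C" for u v
  proof -
    have from_c: "walk_in R C c w" if "walk_in R Y c w" for w
      using that
    proof (induction rule: rtranclp_induct)
      case (step y z)
      have "y \<in> C" using step.hyps(1) by (simp add: C_def)
      moreover have "z \<in> C" using step.hyps by (auto simp: C_def intro: rtranclp.rtrancl_into_rtrancl)
      ultimately show ?case using step by (auto intro: rtranclp.rtrancl_into_rtrancl)
    qed simp
    have "walk_in R C c u" "walk_in R C c v" using that from_c by (auto simp: C_def)
    then show ?thesis using walk_in_sym[OF sym] by (meson rtranclp_trans)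
  qed
  \<comment> \<open>The walk from \<open>s\<close> to \<open>t\<close> runs through
    \<open>C\<close>, where \<open>a\<close> has no neighbours.\<close>
  have clique: "R s t" if st: "s \<in> S" "t \<in> S" "s \<noteq> t" for s t
  proof -
    obtain u v where uv: "u \<in> C" "v \<in> C" "R s u" "R t v" using st by (auto simp: S_def)
    show ?thesis
    proof (rule chord_closed[OF psubset.prems(1) sym irr \<open>a \<in> X\<close>, of "insert s (insert t C)"])
      show "insert s (insert t C) \<subseteq> X" "a \<notin> insert s (insert t C)" "R a s" "R a t" "s \<noteq> t"
        using st CY irr by (auto simp: S_def Y_def dest: irreflpD)
      show "z = s \<or> z = t" if "z \<in> insert s (insert t C)" "R a z" for z
        using that CY by (auto simp: Y_def)
      have "walk_in R (insert s (insert t C)) u v"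
        by (rule walk_in_mono[OF inC]) (use uv in auto)
      then have "walk_in R (insert s (insert t C)) s v"
        using uv by (auto intro: converse_rtranclp_into_rtranclp)
      then show "walk_in R (insert s (insert t C)) s t"
        using uv symR by (auto intro: rtranclp.rtrancl_into_rtrancl)
    qed auto
  qed
  define X' where "X' = C \<union> S"
  have sub: "X' \<subset> X"
    using CY \<open>a \<in> X\<close> irr by (auto simp: X'_def S_def Y_def dest: irreflpD)
  have free': "hole_free R X'" using psubset.prems(1) sub hole_free_mono by blast
  \<comment> \<open>By \<open>nbC\<close> a vertex of \<open>C\<close> has all its neighbours in
    \<open>X'\<close>, so passing from \<open>X'\<close> to \<open>X\<close> adds none.\<close>
  have lift: "simplicial R X b" if "b \<in> C" "simplicial R X' b" for b
    unfolding simplicial_def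
  proof (intro ballI impI)
    fix y z assume "y \<in> X" "z \<in> X" "R b y" "R b z" "y \<noteq> z"
    then show "R y z"
      using that(2) nbC[OF that(1)] unfolding simplicial_def X'_def by blast
  qed
  \<comment> \<open>The induction hypothesis on \<open>X'\<close> returns a simplicial vertex not
    adjacent to a prescribed one, and it has to avoid \<open>S\<close>. If some \<open>s\<close> in
    \<open>S\<close> misses a vertex of \<open>X'\<close>, prescribe \<open>s\<close>: the clique
    \<open>S\<close> cannot contain the result. Otherwise all of \<open>S\<close> is adjacent to
    everything in \<open>X'\<close>, and any prescribed vertex of \<open>C\<close> works.\<close>
  have "\<exists>b\<in>C. simplicial R X' b"
  proof (cases "\<exists>s\<in>X'. \<exists>b\<in>X'. b \<noteq> s \<and> \<not> R s b")
    case False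
    then have "simplicial R X' c" by (auto simp: simplicial_def)
    with cC show ?thesis by blast
  next
    case True
    show ?thesis
    proof (cases "\<exists>s\<in>S. \<exists>b\<in>X'. b \<noteq> s \<and> \<not> R s b")
      case True
      then obtain s where s: "s \<in> S" "\<exists>b\<in>X'. b \<noteq> s \<and> \<not> R s b" by blast
      then obtain b where "b \<in> X'" "b \<noteq> s" "\<not> R s b" "simplicial R X' b"
        using psubset.IH[OF sub free' sym irr] by (metis X'_def UnI2)
      then show ?thesis using clique s by (auto simp: X'_def)
    next
      case False
      then obtain s where s: "s \<in> C" "\<exists>b\<in>X'. b \<noteq> s \<and> \<not> R s b"
        using \<open>\<exists>s\<in>X'. \<exists>b\<in>X'. b \<noteq> s \<and> \<not> R s b\<close> by (auto simp: X'_def)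
      then obtain b where b: "b \<in> X'" "b \<noteq> s" "\<not> R s b" "simplicial R X' b"
        using psubset.IH[OF sub free' sym irr] by (metis X'_def UnI1)
      then have "b \<notin> S" using False s by (auto simp: X'_def symR)
      then show ?thesis using b by (auto simp: X'_def)
    qed
  qed
  then show ?case using lift CY by (fastforce simp: Y_def)
qed

lemma hole_free_simplicial:
  assumes "finite X" "hole_free R X" "symp R" "irreflp R" "X \<noteq> {}"
  obtains b where "b \<in> X" "simplicial R X b"
proof (cases "\<exists>a\<in>X. \<exists>b\<in>X. b \<noteq> a \<and> \<not> R a b")
  case True
  then show thesis using simplicial_non_neighbour[OF assms(1-4)] that by blast
next
  case False
  obtain b where "b \<in> X" using \<open>X \<noteq> {}\<close> by blast
  moreover have "simplicial R X b" using False by (auto simp: simplicial_def)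
  ultimately show thesis by (rule that)
qed


section \<open>The square of a chordal graph without induced \<open>S\<^bsub>1,2,3\<^esub>\<close>\<close>

locale chordal_S123_free =
  fixes G :: "'a ugraph"
  assumes simple: "simple_graph G" and S123: "induced_free S123 G" and chordal: "chordal G"
begin

abbreviation V where "V \<equiv> verts G"
abbreviation adj where "adj u v \<equiv> {u, v} \<in> edges G"
abbreviation N where "N \<equiv> closed_nbhd G"

lemma adj_verts: "adj u v \<Longrightarrow> u \<in> V" "adj u v \<Longrightarrow> v \<in> V"
  using simple by (auto simp: simple_graph_def)

lemma adj_irrefl: "\<not> adj u u"
  using simple by (auto simp: simple_graph_def)

lemma adj_sym: "adj u v \<longleftrightarrow> adj v u"
  by (simp add: insert_commute)

lemma in_N: "u \<in> N v \<longleftrightarrow> u \<in> V \<and> (u = v \<or> adj u v)"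
  by (auto simp: closed_nbhd_def)

lemma N_sym: "u \<in> V \<Longrightarrow> v \<in> V \<Longrightarrow> u \<in> N v \<longleftrightarrow> v \<in> N u"
  by (auto simp: in_N adj_sym)

lemma adj_cycle_graph:
  "i < k \<Longrightarrow> j < k \<Longrightarrow> {i, j} \<in> edges (cycle_graph k) \<longleftrightarrow> j = Suc i mod k \<or> i = Suc j mod k"
  by (auto simp: cycle_graph_def doubleton_eq_iff)

lemma verts_cycle_graph: "verts (cycle_graph k) = {..<k}"
  by (simp add: cycle_graph_def)

lemma hole_free_G: "hole_free adj V"
  unfolding hole_free_def
proof (intro allI notI)
  fix k f assume h: "hole adj V k f"
  then have "has_induced_copy (cycle_graph k) G"
    unfolding has_induced_copy_def hole_def
    by (intro exI[of _ f]) (simp add: verts_cycle_graph adj_cycle_graph)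
  then show False using chordal h by (auto simp: chordal_def induced_free_def hole_def)
qed

lemma chord:
  assumes "a \<in> V" "Z \<subseteq> V" "a \<notin> Z" "adj a s" "adj a t" "s \<in> Z" "t \<in> Z" "s \<noteq> t"
    and "\<And>z. z \<in> Z \<Longrightarrow> adj a z \<Longrightarrow> z = s \<or> z = t"
    and "walk_in adj Z s t"
  shows "adj s t"
  by (rule chord_closed[OF hole_free_G _ _ assms(1-8)])
    (use assms(9,10) adj_sym adj_irrefl in \<open>auto simp: symp_def irreflp_def\<close>)

lemma walk_in_adj: "adj u v \<Longrightarrow> u \<in> Z \<Longrightarrow> v \<in> Z \<Longrightarrow> walk_in adj Z u v"
  by (simp add: r_into_rtranclp)

text \<open>The copy has centre \<open>x\<close> and the branches \<open>a'\<close>, then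
  \<open>a\<close>, \<open>w\<close>, and then \<open>y\<close>, \<open>b\<close>, \<open>p\<close>.
  The non-adjacencies missing from the hypotheses follow from chordality: any further edge among
  these vertices would connect \<open>a\<close> or \<open>a'\<close> to \<open>y\<close> outside the
  neighbourhood of \<open>x\<close>.\<close>

lemma broom_S123:
  assumes xy: "adj x y" and xa: "adj x a" "adj x a'" and yb: "adj y b" and aw: "adj a w" and bp: "adj b p"
    and ne: "a \<noteq> a'" "\<not> adj a a'" and ay: "\<not> adj a y" "\<not> adj a' y"
    and ab: "\<not> adj a b" "\<not> adj a' b" and bx: "\<not> adj b x" "b \<noteq> x"
    and w: "w \<noteq> x" "\<not> adj w x" "\<not> adj w a'"
    and p: "p \<noteq> x" "\<not> adj p x" "p \<noteq> y" "\<not> adj p y"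
  shows False
proof -
  note V = adj_verts[OF xy] adj_verts[OF xa(1)] adj_verts[OF xa(2)] adj_verts[OF yb]
    adj_verts[OF aw] adj_verts[OF bp]
  \<comment> \<open>Within \<open>insert c (insert y Z)\<close> the vertex \<open>x\<close> sees
    only \<open>c\<close> and \<open>y\<close>, so a walk between them would force the edge
    \<open>c y\<close>.\<close>
  have sep: False
    if "adj x c" "\<not> adj c y" "c \<noteq> y" "Z \<subseteq> V" "\<And>z. z \<in> Z \<Longrightarrow> z \<noteq> x \<and> \<not> adj z x"
      "walk_in adj (insert c (insert y Z)) c y" for c Z
  proof -
    have nbs: "z = c \<or> z = y" if "z \<in> insert c (insert y Z)" "adj x z" for z
      using \<open>\<And>z. z \<in> Z \<Longrightarrow> z \<noteq> x \<and> \<not> adj z x\<close>[of z] that adj_sym[of x z] by blast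
    have x: "x \<notin> insert c (insert y Z)"
      using that(1,5) xy adj_irrefl[of x] by blast
    have "adj c y"
    proof (rule chord[OF V(1) _ x that(1) xy _ _ that(3) nbs that(6)])
      show "insert c (insert y Z) \<subseteq> V"
        using that(4) V(2) adj_verts(2)[OF that(1)] by blast
    qed auto
    then show False using that by simp
  qed
  have ny: "a \<noteq> y" "a' \<noteq> y" "w \<noteq> y"
    using ay ab w yb xy aw adj_sym by metis+
  have wb: "walk_in adj (insert c (insert y {w, b, p})) b y" for c
    using yb by (intro walk_in_adj) (auto simp: adj_sym)
  have wp: "walk_in adj (insert c (insert y {w, b, p})) p y" for c
    by (rule rtranclp_trans[OF walk_in_adj wb]) (use bp adj_sym in auto)
  have aw': "walk_in adj (insert a (insert y {w, b, p})) a w"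
    using aw by (intro walk_in_adj) auto
  note Z = sep[where Z = "{w, b, p}"]
  have side: "{w, b, p} \<subseteq> V" "\<And>z. z \<in> {w, b, p} \<Longrightarrow> z \<noteq> x \<and> \<not> adj z x"
    using V bx w p by auto
  have wy: "\<not> adj w y"
    using Z[of a] xa ay ny side rtranclp_trans[OF aw' walk_in_adj[of w y]] by auto
  have wnb: "\<not> adj w b" "w \<noteq> b"
    using Z[of a] xa ay ny side rtranclp_trans[OF aw' rtranclp_trans[OF walk_in_adj[of w b] wb]]
      rtranclp_trans[OF aw'] wb by auto
  have wnp: "\<not> adj w p" "w \<noteq> p"
    using Z[of a] xa ay ny side rtranclp_trans[OF aw' rtranclp_trans[OF walk_in_adj[of w p] wp]]
      rtranclp_trans[OF aw'] wp by auto
  have ap: "\<not> adj a p"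
    using Z[of a] xa ay ny side rtranclp_trans[OF walk_in_adj[of a p] wp] by auto
  have a'p: "\<not> adj a' p"
    using Z[of a'] xa ay ny side rtranclp_trans[OF walk_in_adj[of a' p] wp] by auto
  \<comment> \<open>The order of the list follows the numbering of \<open>S123\<close>: centre,
    branch 1, branch 2 and 3, branch 4, 5 and 6.\<close>
  define f where "f i = [x, a', a, w, y, b, p] ! i" for i :: nat
  have verts7: "verts S123 = {0, 1, 2, 3, 4, 5, 6}"
    by (auto simp: S123_def)
  have vals: "f 0 = x" "f 1 = a'" "f 2 = a" "f 3 = w" "f 4 = y" "f 5 = b" "f 6 = p" "f (Suc 0) = a'"
    by (simp_all add: f_def)
  have dist: "distinct [x, a', a, w, y, b, p]"
    using adj_irrefl xy xa yb aw bp ne ay ab bx w p ny wy wnb wnp ap a'p adj_sym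
    by (simp) metis
  define E where "E u v \<longleftrightarrow> adj u v" for u v
  have E_sym: "E u v \<longleftrightarrow> E v u" for u v
    unfolding E_def by (rule adj_sym)
  have E_pos: "E x y" "E x a" "E x a'" "E y b" "E a w" "E b p"
    using xy xa yb aw bp by (simp_all only: E_def)
  have E_neg: "\<not> E a a'" "\<not> E a y" "\<not> E a' y" "\<not> E a b" "\<not> E a' b" "\<not> E b x" "\<not> E w x" "\<not> E w a'"
      "\<not> E p x" "\<not> E p y" "\<not> E w y" "\<not> E w b" "\<not> E w p" "\<not> E a p" "\<not> E a' p" "\<And>u. \<not> E u u"
    using ne ay ab bx w p wy wnb wnp ap a'p adj_irrefl by (simp_all only: E_def not_False_eq_True)
  have E_neg': "\<not> E a' a" "\<not> E y a" "\<not> E y a'" "\<not> E b a" "\<not> E b a'" "\<not> E x b" "\<not> E x w" "\<not> E a' w"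
      "\<not> E x p" "\<not> E y p" "\<not> E y w" "\<not> E b w" "\<not> E p w" "\<not> E p a" "\<not> E p a'"
    using E_neg E_sym by metis+
  have S: "{i, j} \<in> edges S123 \<longleftrightarrow> (i, j) \<in> set [(0,1),(1,0),(0,2),(2,0),(2,3),(3,2),(0,4),(4,0),(4,5),(5,4),(5,6),(6,5)]" for i j
    by (auto simp: S123_def doubleton_eq_iff)
  have "\<forall>i\<in>verts S123. \<forall>j\<in>verts S123. E (f i) (f j) \<longleftrightarrow> {i, j} \<in> edges S123"
    unfolding verts7 S
    using E_pos E_pos[THEN E_sym[THEN iffD1]] E_neg E_neg'
    by (simp add: vals)
  then have edges: "\<forall>i\<in>verts S123. \<forall>j\<in>verts S123. adj (f i) (f j) \<longleftrightarrow> {i, j} \<in> edges S123"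
    by (simp only: E_def)
  have "inj_on f (verts S123)"
    unfolding verts7 using dist by (simp add: vals inj_on_def) metis
  moreover have "f ` verts S123 \<subseteq> V"
    unfolding verts7 using V by (auto simp: vals)
  ultimately have "has_induced_copy S123 G"
    unfolding has_induced_copy_def using edges by blast
  then show False using S123 by (simp add: induced_free_def)
qed

end


section \<open>Nearness and efficient domination\<close>

definition near :: "'a ugraph \<Rightarrow> 'a \<Rightarrow> 'a \<Rightarrow> bool" where
  "near G u v \<longleftrightarrow> closed_nbhd G u \<inter> closed_nbhd G v \<noteq> {}"

text \<open>
  The square of the whole graph may contain holes, even if there is an e.d.s.; an admissible vertex
  passes a local test that the members of every e.d.s. pass, and the square is hole-free on those.
\<close>

definition admissible :: "'a ugraph \<Rightarrow> 'a set" where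
  "admissible G = {v \<in> verts G. \<forall>u\<in>verts G. \<exists>w\<in>closed_nbhd G u. w = v \<or> \<not> near G w v}"

lemma near_sym: "near G u v \<longleftrightarrow> near G v u"
  by (auto simp: near_def)

lemma near_refl: "v \<in> verts G \<Longrightarrow> near G v v"
  by (auto simp: near_def closed_nbhd_def)

lemma closed_nbhd_sym: "u \<in> closed_nbhd G v \<Longrightarrow> v \<in> verts G \<Longrightarrow> v \<in> closed_nbhd G u"
  by (auto simp: closed_nbhd_def insert_commute)

text \<open>A vertex in both closed neighbourhoods would be dominated by \<open>d\<close> and by
  \<open>e\<close>.\<close>

lemma eds_near_eq:
  assumes "eds G D" "d \<in> D" "e \<in> D" "near G d e"
  shows "d = e"
proof -
  obtain z where z: "z \<in> closed_nbhd G d" "z \<in> closed_nbhd G e"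
    using assms(4) by (auto simp: near_def)
  have "z \<in> verts G" "d \<in> verts G" "e \<in> verts G"
    using assms z by (auto simp: eds_def closed_nbhd_def)
  then have "card (D \<inter> closed_nbhd G z) = 1" "d \<in> D \<inter> closed_nbhd G z" "e \<in> D \<inter> closed_nbhd G z"
    using assms(1-3) closed_nbhd_sym[OF z(1)] closed_nbhd_sym[OF z(2)] by (simp_all add: eds_def)
  then show ?thesis by (metis card_1_singletonE singletonD)
qed

lemma eds_dominator:
  assumes "eds G D" "v \<in> verts G"
  obtains d where "d \<in> D" "d \<in> closed_nbhd G v"
proof -
  have "card (D \<inter> closed_nbhd G v) = 1" using assms by (simp add: eds_def)
  then show thesis using that by (auto simp: card_1_singleton_iff)
qed

text \<open>The witness \<open>w\<close> for \<open>u\<close> is the dominator of \<open>u\<close>: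
  it lies in \<open>D\<close> like \<open>v\<close>, so it equals \<open>v\<close> or is not near
  \<open>v\<close>.\<close>

lemma eds_admissible:
  assumes "eds G D"
  shows "D \<subseteq> admissible G"
proof
  fix v assume v: "v \<in> D"
  have "\<exists>w\<in>closed_nbhd G u. w = v \<or> \<not> near G w v" if "u \<in> verts G" for u
    using eds_dominator[OF assms that] eds_near_eq[OF assms _ v] by metis
  then show "v \<in> admissible G"
    using v assms by (auto simp: admissible_def eds_def)
qed

section \<open>Adjacent midpoints with private neighbours\<close>

context chordal_S123_free
begin

lemma nearI: "z \<in> N u \<Longrightarrow> z \<in> N v \<Longrightarrow> near G u v"
  by (auto simp: near_def)

text \<open>If \<open>x\<close> were in \<open>D\<close>, then \<open>x\<close> would dominate both
  \<open>a\<close> and \<open>a'\<close>, so no second dominator could serve as the end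
  \<open>w\<close>. Admissibility of \<open>a'\<close>, tested at \<open>a\<close>, supplies
  \<open>w\<close> instead. The end \<open>p\<close> is the dominator of \<open>b\<close>: it
  differs from \<open>x\<close>, so it is far from \<open>x\<close> and not adjacent to
  \<open>y\<close>.\<close>

lemma broom_center_not_in_eds:
  assumes D: "eds G D" and xy: "adj x y" and xa: "adj x a" "adj x a'" and yb: "adj y b"
    and ne: "a \<noteq> a'" "\<not> adj a a'" and ay: "\<not> adj a y" "\<not> adj a' y"
    and ab: "\<not> adj a b" "\<not> adj a' b" and bx: "\<not> adj b x"
    and adm: "a' \<in> admissible G"
  shows "x \<notin> D"
proof
  assume x: "x \<in> D"
  note V = adj_verts[OF xy] adj_verts[OF xa(1)] adj_verts[OF xa(2)] adj_verts[OF yb]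
  have bx': "b \<noteq> x" using xa(1) ab(1) adj_sym by metis
  obtain w where w: "w \<in> N a" "w = a' \<or> \<not> near G w a'"
    using adm V by (auto simp: admissible_def)
  have "w \<noteq> a'" using w(1) ne by (auto simp: in_N adj_sym)
  with w have nw: "\<not> near G w a'" by simp
  have wV: "w \<in> V" using w by (simp add: in_N)
  have xNa: "x \<in> N a'" "x \<in> N a" using xa V by (simp_all add: in_N)
  have "x \<notin> N w" using nw xNa(1) nearI by blast
  then have wx: "w \<noteq> x" "\<not> adj w x" using V by (auto simp: in_N adj_sym)
  have "w \<noteq> a" using wx(2) xa(1) adj_sym by metis
  then have aw: "adj a w" using w(1) by (auto simp: in_N adj_sym)
  have "w \<notin> N a'" using nw nearI[of w w a'] wV by (auto simp: in_N)
  then have wa': "\<not> adj w a'" using wV by (auto simp: in_N)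
  obtain p where p: "p \<in> D" "p \<in> N b" by (rule eds_dominator[OF D V(8)])
  have px: "p \<noteq> x" using p(2) bx bx' by (auto simp: in_N adj_sym)
  then have far: "\<not> near G p x" using eds_near_eq[OF D p(1) x] by blast
  have pV: "p \<in> V" using p(2) by (simp add: in_N)
  have "p \<notin> N x" "p \<notin> N y" "y \<notin> N p"
    using far nearI[of p p x] nearI[of y p x] V pV xy by (auto simp: in_N adj_sym)
  then have p': "\<not> adj p x" "p \<noteq> y" "\<not> adj p y" using pV V by (auto simp: in_N)
  have "p \<noteq> b" using p' yb adj_sym by metis
  then have bp: "adj b p" using p(2) by (auto simp: in_N adj_sym)
  show False
    by (rule broom_S123[OF xy xa yb aw bp ne ay ab bx bx' wx wa' px p'])
qed

text \<open>With \<open>x\<close> outside \<open>D\<close>, the assumption \<open>rule\<close> makes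
  the dominators of the two leaves distinct. They are then not near each other, so \<open>x\<close>
  is outside the closed neighbourhood of one of them. That one is not the leaf itself, since the
  leaf is adjacent to \<open>x\<close>.\<close>

lemma broom_private_dominator:
  assumes D: "eds G D" and xa: "adj x a\<^sub>1" "adj x a\<^sub>2"
    and rule: "\<And>d. d \<in> D \<Longrightarrow> d \<in> N a\<^sub>1 \<Longrightarrow> d \<in> N a\<^sub>2 \<Longrightarrow> d = x" and x: "x \<notin> D"
  obtains a a' d where "{a, a'} = {a\<^sub>1, a\<^sub>2}" "d \<in> D" "adj a d" "d \<notin> N x" "d \<notin> N a'"
proof -
  note V = adj_verts[OF xa(1)] adj_verts[OF xa(2)]
  obtain d\<^sub>1 where d1: "d\<^sub>1 \<in> D" "d\<^sub>1 \<in> N a\<^sub>1" by (rule eds_dominator[OF D V(2)])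
  obtain d\<^sub>2 where d2: "d\<^sub>2 \<in> D" "d\<^sub>2 \<in> N a\<^sub>2" by (rule eds_dominator[OF D V(4)])
  have ne: "d\<^sub>1 \<noteq> d\<^sub>2" and n1: "d\<^sub>1 \<notin> N a\<^sub>2" and n2: "d\<^sub>2 \<notin> N a\<^sub>1"
    using rule d1 d2 x by blast+
  have "x \<notin> N d\<^sub>1 \<or> x \<notin> N d\<^sub>2"
    using ne eds_near_eq[OF D d1(1) d2(1)] nearI by blast
  moreover have "d\<^sub>1 \<in> V" "d\<^sub>2 \<in> V" using d1 d2 by (auto simp: in_N)
  ultimately have "d\<^sub>1 \<notin> N x \<or> d\<^sub>2 \<notin> N x" using N_sym V by blast
  moreover have "d\<^sub>1 = a\<^sub>1 \<or> adj a\<^sub>1 d\<^sub>1" "d\<^sub>2 = a\<^sub>2 \<or> adj a\<^sub>2 d\<^sub>2"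
    using d1 d2 by (auto simp: in_N adj_sym)
  moreover have "a\<^sub>1 \<in> N x" "a\<^sub>2 \<in> N x" using xa V by (auto simp: in_N adj_sym)
  ultimately consider "d\<^sub>1 \<notin> N x" "adj a\<^sub>1 d\<^sub>1" | "d\<^sub>2 \<notin> N x" "adj a\<^sub>2 d\<^sub>2" by blast
  then show thesis
    using that[of a\<^sub>1 a\<^sub>2 d\<^sub>1] that[of a\<^sub>2 a\<^sub>1 d\<^sub>2] d1 d2 n1 n2 by cases auto
qed

text \<open>Both ends of the edge \<open>x y\<close> lie outside \<open>D\<close> by
  \<open>broom_center_not_in_eds\<close>, applied in both directions. The private dominators on the
  two sides then become the ends \<open>w\<close> and \<open>p\<close> in
  \<open>broom_S123\<close>.\<close>

lemma double_broom:
  assumes D: "eds G D" and xy: "adj x y" and xa: "adj x a\<^sub>1" "adj x a\<^sub>2" and yb: "adj y b\<^sub>1" "adj y b\<^sub>2"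
    and na: "a\<^sub>1 \<noteq> a\<^sub>2" "\<not> adj a\<^sub>1 a\<^sub>2" and nb: "b\<^sub>1 \<noteq> b\<^sub>2" "\<not> adj b\<^sub>1 b\<^sub>2"
    and ay: "\<not> adj a\<^sub>1 y" "\<not> adj a\<^sub>2 y" and bx: "\<not> adj b\<^sub>1 x" "\<not> adj b\<^sub>2 x"
    and ab: "\<not> adj a\<^sub>1 b\<^sub>1" "\<not> adj a\<^sub>1 b\<^sub>2" "\<not> adj a\<^sub>2 b\<^sub>1" "\<not> adj a\<^sub>2 b\<^sub>2"
    and adm: "a\<^sub>2 \<in> admissible G" "b\<^sub>2 \<in> admissible G"
    and rx: "\<And>d. d \<in> D \<Longrightarrow> d \<in> N a\<^sub>1 \<Longrightarrow> d \<in> N a\<^sub>2 \<Longrightarrow> d = x"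
    and ry: "\<And>d. d \<in> D \<Longrightarrow> d \<in> N b\<^sub>1 \<Longrightarrow> d \<in> N b\<^sub>2 \<Longrightarrow> d = y"
  shows False
proof -
  have yx: "adj y x" using xy adj_sym by metis
  have x: "x \<notin> D"
    by (rule broom_center_not_in_eds[OF D xy xa yb(1) na ay _ _ bx(1) adm(1)]) (use ab in auto)
  have y: "y \<notin> D"
    by (rule broom_center_not_in_eds[OF D yx yb xa(1) nb bx _ _ ay(1) adm(2)]) (use ab adj_sym in metis)+
  obtain a a' d where a: "{a, a'} = {a\<^sub>1, a\<^sub>2}" and d: "d \<in> D" "adj a d" "d \<notin> N x" "d \<notin> N a'"
    by (rule broom_private_dominator[OF D xa rx x])
  obtain b b' e where b: "{b, b'} = {b\<^sub>1, b\<^sub>2}" and e: "e \<in> D" "adj b e" "e \<notin> N y" "e \<notin> N b'"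
    by (rule broom_private_dominator[OF D yb ry y])
  have a': "adj x a" "adj x a'" "a \<noteq> a'" "\<not> adj a a'" "\<not> adj a y" "\<not> adj a' y"
    using a xa na ay adj_sym by (auto simp: doubleton_eq_iff)
  have b': "adj y b" "\<not> adj b x" "\<not> adj a b" "\<not> adj a' b"
    using a b yb bx ab by (auto simp: doubleton_eq_iff)
  have V: "d \<in> V" "e \<in> V" using adj_verts d e by blast+
  have d': "d \<noteq> x" "\<not> adj d x" "\<not> adj d a'" using d V by (auto simp: in_N)
  have e': "e \<noteq> y" "\<not> adj e y" using e V by (auto simp: in_N)
  have "e \<noteq> x" using x e by blast
  moreover have "\<not> adj e x"
  \<comment> \<open>Otherwise \<open>y\<close>, \<open>b\<close>, \<open>e\<close>, \<open>x\<close>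
    form a 4-cycle both of whose chords are excluded.\<close>
  proof
    assume ex: "adj e x"
    have "adj b x"
    proof (rule chord[of y "{b, e, x}"])
      show "walk_in adj {b, e, x} b x"
        using e ex by (intro rtranclp_trans[OF walk_in_adj[of b e] walk_in_adj[of e x]]) auto
      show "z = b \<or> z = x" if "z \<in> {b, e, x}" "adj y z" for z
        using that e' adj_sym[of y e] by blast
      show "y \<notin> {b, e, x}" using e' yx b' adj_irrefl by blast
      show "b \<noteq> x" using b'(3) a'(1) adj_sym by metis
      show "y \<in> V" "{b, e, x} \<subseteq> V" using V adj_verts xy b' by blast+
    qed (use b' yx in auto)
    then show False using b' by simp
  qed
  moreover have "b \<noteq> x" using b'(3) a'(1) adj_sym by metis
  ultimately show False
    using broom_S123[OF xy a'(1,2) b'(1) d(2) e(2) a'(3-6) b'(3,4,2)] d' e' by blast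
qed

end


text \<open>
  A hole \<open>s\<^sub>0, \<dots>, s\<^bsub>k-1\<^esub>\<close> of the square comes with midpoints \<open>m\<^sub>i\<close> of \<open>s\<^sub>i\<close> and \<open>s\<^bsub>i+1\<^esub>\<close>. Both
  sequences are indexed periodically, so that every index may play the role of 0.
\<close>

locale square_hole = chordal_S123_free G for G :: "'a ugraph" +
  fixes k :: nat and s m :: "nat \<Rightarrow> 'a"
  assumes k: "4 \<le> k"
    and period: "\<And>i. s (i + k) = s i" "\<And>i. m (i + k) = m i"
    and sV: "\<And>i. s i \<in> verts G"
    and step_neq: "\<And>i. s i \<noteq> s (Suc i)"
    and far: "\<And>i d. 2 \<le> d \<Longrightarrow> d + 2 \<le> k \<Longrightarrow> \<not> near G (s i) (s (i + d))"
    and mid: "\<And>i. m i \<in> closed_nbhd G (s i)" "\<And>i. m i \<in> closed_nbhd G (s (Suc i))"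
begin

section \<open>Chordality around a hole of the square\<close>

lemma mV: "m i \<in> V"
  using mid(1)[of i] by (simp add: in_N)

text \<open>Of the two hole vertices that \<open>m (i + d)\<close> joins, at least one is at cyclic
  distance 2 or more from \<open>s i\<close>, and it would be near \<open>s i\<close>.\<close>

lemma mid_notin: "1 \<le> d \<Longrightarrow> d + 2 \<le> k \<Longrightarrow> m (i + d) \<notin> N (s i)"
proof
  assume d: "1 \<le> d" "d + 2 \<le> k" and "m (i + d) \<in> N (s i)"
  then have "near G (s i) (s (i + d))" "near G (s i) (s (i + Suc d))"
    using mid[of "i + d"] nearI by auto
  then show False using far[of d i] far[of "Suc d" i] d k by (cases "d = 1") auto
qed

lemma far_adj: "2 \<le> d \<Longrightarrow> d + 2 \<le> k \<Longrightarrow> \<not> adj (s i) (s (i + d))"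
  using far[of d i] nearI[of "s i" "s i" "s (i + d)"] sV by (auto simp: in_N)

lemma far_neq: "2 \<le> d \<Longrightarrow> d + 2 \<le> k \<Longrightarrow> s i \<noteq> s (i + d)"
  using far[of d i] near_refl[OF sV] by metis

lemma walk_in_trans: "walk_in adj Z u v \<Longrightarrow> walk_in adj Z v w \<Longrightarrow> walk_in adj Z u w"
  by (rule rtranclp_trans)

lemma walk_s:
  assumes "\<And>t. t \<le> r \<Longrightarrow> s (j + t) \<in> Z" "\<And>t. t < r \<Longrightarrow> m (j + t) \<in> Z"
  shows "walk_in adj Z (s j) (s (j + r))"
  using assms
proof (induction r)
  case (Suc r)
  have 1: "walk_in adj Z (s j) (s (j + r))" using Suc by auto
  have 2: "walk_in adj Z (s (j + r)) (m (j + r))"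
    using mid(1)[of "j + r"] Suc.prems(1)[of r] Suc.prems(2)[of r] adj_sym[of "m (j + r)"]
    by (cases "m (j + r) = s (j + r)") (auto simp: in_N intro!: walk_in_adj)
  have 3: "walk_in adj Z (m (j + r)) (s (j + Suc r))"
    using mid(2)[of "j + r"] Suc.prems(1)[of "Suc r"] Suc.prems(2)[of r]
    by (cases "m (j + r) = s (j + Suc r)") (auto simp: in_N intro!: walk_in_adj)
  show ?case by (rule walk_in_trans[OF walk_in_trans[OF 1 2] 3])
qed simp

text \<open>The closed walk through the \<open>s\<close> and \<open>m\<close> without
  \<open>s i\<close> and without the two midpoints at \<open>s i\<close>, which are
  \<open>m i\<close> and, read cyclically, \<open>m (i + (k - 1))\<close>. It serves as the set
  \<open>Z\<close> of \<open>chord\<close> with \<open>a = s i\<close>.\<close>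

definition arc :: "nat \<Rightarrow> 'a set" where
  "arc i = (\<lambda>d. s (i + d)) ` {1..k - 1} \<union> (\<lambda>d. m (i + d)) ` {1..k - 2}"

lemma arc_sub: "arc i \<subseteq> V"
  using sV mV by (auto simp: arc_def)

lemma arcI: "1 \<le> d \<Longrightarrow> d \<le> k - 1 \<Longrightarrow> s (i + d) \<in> arc i" "1 \<le> d \<Longrightarrow> d \<le> k - 2 \<Longrightarrow> m (i + d) \<in> arc i"
  by (auto simp: arc_def)

lemma arc_walk:
  assumes "arc i \<subseteq> Z"
  shows "walk_in adj Z (s (i + 1)) (s (i + (k - 1)))"
proof -
  have eq: "i + (k - 1) = i + 1 + (k - 2)" using k by simp
  show ?thesis
    unfolding eq
  proof (rule walk_s)
    show "s (i + 1 + t) \<in> Z" if "t \<le> k - 2" for t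
      using that k arcI(1)[of "1 + t" i] assms by (auto simp: add.assoc)
    show "m (i + 1 + t) \<in> Z" if "t < k - 2" for t
      using that k arcI(2)[of "1 + t" i] assms by (auto simp: add.assoc)
  qed
qed

lemma arc_ends: "s (i + 1) \<in> arc i" "s (i + (k - 1)) \<in> arc i"
  using k by (intro arcI; simp)+

text \<open>The inner hole vertices of the arc are far from \<open>s i\<close>, and its midpoints
  are excluded by \<open>mid_notin\<close>; only the two ends remain. The disjunct
  \<open>z = s i\<close> is kept here and refuted in \<open>s_notin_arc\<close>, where
  \<open>step_neq\<close> is applied at both ends.\<close>

lemma arc_nbs:
  assumes "z \<in> arc i" "z = s i \<or> adj (s i) z"
  shows "(z = s (i + 1) \<or> z = s (i + (k - 1))) \<and> adj (s i) z \<or> z = s i \<and> (s (i + 1) = s i \<or> s (i + (k - 1)) = s i)"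
proof -
  have zN: "z \<in> N (s i)" using assms arc_sub adj_sym by (auto simp: in_N)
  consider d where "1 \<le> d" "d \<le> k - 1" "z = s (i + d)" | d where "1 \<le> d" "d \<le> k - 2" "z = m (i + d)"
    using assms by (auto simp: arc_def)
  then show ?thesis
  proof cases
    case 1
    consider "d = 1" | "d = k - 1" | "2 \<le> d" "d + 2 \<le> k" using 1 by linarith
    then show ?thesis
      using 1 assms far_adj[of d i] far_neq[of d i] by cases auto
  next
    case 2
    then show ?thesis using mid_notin[of d i] zN k by auto
  qed
qed

lemma last_mid: "m (i + (k - 1)) \<in> N (s (i + (k - 1)))" "m (i + (k - 1)) \<in> N (s i)"
proof -
  have "Suc (i + (k - 1)) = i + k" using k by simp
  then show "m (i + (k - 1)) \<in> N (s (i + (k - 1)))" "m (i + (k - 1)) \<in> N (s i)"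
    using mid[of "i + (k - 1)"] period(1) by simp_all
qed

lemma ends: "s (i + 1) \<noteq> s (i + (k - 1))" "\<not> adj (s (i + 1)) (s (i + (k - 1)))"
proof -
  have "i + (k - 1) = (i + 1) + (k - 2)" using k by simp
  then show "s (i + 1) \<noteq> s (i + (k - 1))" "\<not> adj (s (i + 1)) (s (i + (k - 1)))"
    using far_neq[of "k - 2" "i + 1"] far_adj[of "k - 2" "i + 1"] k by simp_all
qed

lemma last_mid_notin: "m (i + (k - 1)) \<notin> N (s (i + 1))"
proof -
  have "i + (k - 1) = (i + 1) + (k - 2)" using k by simp
  then show ?thesis using mid_notin[of "k - 2" "i + 1"] k by simp
qed

lemma s_notin_arc: "s i \<notin> arc i"
proof -
  have "s (i + (k - 1)) \<noteq> s (Suc (i + (k - 1)))" by (rule step_neq)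
  moreover have "s (Suc (i + (k - 1))) = s i" using period(1)[of i] k by simp
  ultimately show ?thesis
    using arc_nbs[of "s i" i] step_neq[of i] adj_irrefl by fastforce
qed

text \<open>If \<open>s i\<close> is adjacent to both ends of the arc, chordality joins these ends,
  which are far from each other. If it is adjacent to the first end only, its previous midpoint
  replaces the other end, and chordality joins that midpoint to \<open>s (i + 1)\<close>, against
  \<open>mid_notin\<close>.\<close>

lemma no_step_adj: "\<not> adj (s i) (s (i + 1))"
proof
  assume e: "adj (s i) (s (i + 1))"
  show False
  proof (cases "adj (s i) (s (i + (k - 1)))")
    case True
    have "adj (s (i + 1)) (s (i + (k - 1)))"
    proof (rule chord[of "s i" "arc i"])
      show "z = s (i + 1) \<or> z = s (i + (k - 1))" if "z \<in> arc i" "adj (s i) z" for z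
        using arc_nbs[of z i] that s_notin_arc[of i] by auto
    qed (use sV arc_sub s_notin_arc e True arc_ends ends arc_walk in auto)
    then show False using ends by simp
  next
    case False
    define z' where "z' = m (i + (k - 1))"
    have z': "z' \<in> N (s (i + (k - 1)))" "z' \<in> N (s i)" "z' \<notin> N (s (i + 1))"
      using last_mid last_mid_notin by (simp_all add: z'_def)
    have z's: "z' \<noteq> s i" "z' \<noteq> s (i + (k - 1))"
      using z' False adj_sym s_notin_arc[of i] arc_ends(2)[of i] by (auto simp: in_N)
    then have zz: "adj (s i) z'" "adj (s (i + (k - 1))) z'"
      using z' adj_sym by (auto simp: in_N)
    have "adj (s (i + 1)) z'"
    proof (rule chord[of "s i" "insert z' (arc i)"])
      show "z = s (i + 1) \<or> z = z'" if "z \<in> insert z' (arc i)" "adj (s i) z" for z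
        using arc_nbs[of z i] that s_notin_arc[of i] False by auto
      have 1: "walk_in adj (insert z' (arc i)) (s (i + 1)) (s (i + (k - 1)))"
        by (rule arc_walk) auto
      have 2: "walk_in adj (insert z' (arc i)) (s (i + (k - 1))) z'"
        by (rule walk_in_adj) (use zz arc_ends in auto)
      show "walk_in adj (insert z' (arc i)) (s (i + 1)) z'"
        by (rule walk_in_trans[OF 1 2])
      show "s (i + 1) \<noteq> z'" using z' sV by (auto simp: in_N)
      show "s i \<notin> insert z' (arc i)" using z's s_notin_arc by auto
      show "insert z' (arc i) \<subseteq> V" using arc_sub z' by (auto simp: in_N)
    qed (use sV e zz arc_ends in auto)
    then show False using z' adj_sym by (auto simp: in_N)
  qed
qed

lemma no_last_adj: "\<not> adj (s i) (s (i + (k - 1)))"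
proof -
  have "i + (k - 1) + 1 = i + k" using k by simp
  then show ?thesis using no_step_adj[of "i + (k - 1)"] period(1)[of i] adj_sym by metis
qed

lemma mid_neq: "m i \<noteq> s i" "m (i + (k - 1)) \<noteq> s i"
  using mid(2)[of i] no_step_adj[of i] step_neq[of i] last_mid(1)[of i] no_last_adj[of i] s_notin_arc[of i] arc_ends(2)[of i]
    adj_sym by (auto simp: in_N)

lemma mid_adj: "adj (s i) (m i)" "adj (s i) (m (i + (k - 1)))"
  using mid(1)[of i] last_mid(2)[of i] mid_neq[of i] adj_sym by (auto simp: in_N)

lemma mid_adj': "adj (s (i + 1)) (m i)"
  using mid_adj(2)[of "i + 1"] period(2)[of i] k by simp

text \<open>As \<open>s i\<close> is adjacent to neither end of the arc, its only neighbours on the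
  whole closed walk are its two midpoints, and the arc connects them.\<close>

lemma mid_last_adj: "adj (m i) (m (i + (k - 1)))"
proof (rule chord[of "s i" "insert (m i) (insert (m (i + (k - 1))) (arc i))"])
  let ?Z = "insert (m i) (insert (m (i + (k - 1))) (arc i))"
  show "z = m i \<or> z = m (i + (k - 1))" if "z \<in> ?Z" "adj (s i) z" for z
    using arc_nbs[of z i] that s_notin_arc[of i] no_step_adj[of i] no_last_adj[of i] by auto
  have 1: "walk_in adj ?Z (m i) (s (i + 1))"
    by (rule walk_in_adj) (use mid_adj'[of i] adj_sym arc_ends in auto)
  have 2: "walk_in adj ?Z (s (i + 1)) (s (i + (k - 1)))"
    by (rule arc_walk) auto
  have 3: "walk_in adj ?Z (s (i + (k - 1))) (m (i + (k - 1)))"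
    by (rule walk_in_adj) (use mid_adj(1) arc_ends in auto)
  show "walk_in adj ?Z (m i) (m (i + (k - 1)))"
    by (rule walk_in_trans[OF walk_in_trans[OF 1 2] 3])
  show "m i \<noteq> m (i + (k - 1))" using last_mid_notin[of i] mid(2)[of i] by auto
  show "s i \<notin> ?Z" using mid_neq[of i] s_notin_arc by auto
  show "?Z \<subseteq> V" using arc_sub mV by auto
qed (use sV mid_adj in auto)

lemma mid_step_adj: "adj (m i) (m (Suc i))"
proof -
  have "Suc i + (k - 1) = i + k" using k by simp
  then show ?thesis using mid_last_adj[of "Suc i"] period(2)[of i] adj_sym by metis
qed

lemma independent: "1 \<le> d \<Longrightarrow> d < k \<Longrightarrow> \<not> adj (s i) (s (i + d))"
proof -
  assume "1 \<le> d" "d < k"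
  then consider "d = 1" | "d = k - 1" | "2 \<le> d" "d + 2 \<le> k" by linarith
  then show ?thesis using no_step_adj no_last_adj far_adj by cases auto
qed

lemma mid_inj: "i < j \<Longrightarrow> j < i + k \<Longrightarrow> m i \<noteq> m j"
proof -
  assume ij: "i < j" "j < i + k"
  show ?thesis
  proof (cases "j = i + (k - 1)")
    case True
    then show ?thesis using last_mid_notin[of i] mid(2)[of i] by auto
  next
    case False
    then show ?thesis using mid_notin[of "j - i" i] ij mid(1)[of i] by auto
  qed
qed

text \<open>The \<open>k\<close> midpoints are distinct and cyclically adjacent, so without a
  further edge they would be a hole of the chordal graph.\<close>

lemma mid_chord:
  obtains i d where "2 \<le> d" "d + 2 \<le> k" "adj (m i) (m (i + d))"
proof -
  have "\<not> hole adj V k m" using hole_free_G by (simp add: hole_free_def)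
  moreover have "inj_on m {..<k}"
    by (rule linorder_inj_onI) (use mid_inj in auto)
  ultimately obtain i j where ij: "i < k" "j < k"
      "\<not> (adj (m i) (m j) \<longleftrightarrow> j = Suc i mod k \<or> i = Suc j mod k)"
    using k mV by (auto simp: hole_def)
  have wrap: "m (Suc a mod k) = m (Suc a)" if "a < k" for a
    using that period(2)[of 0] by (cases "Suc a = k") auto
  have "adj (m i) (m j)" "j \<noteq> Suc i mod k" "i \<noteq> Suc j mod k"
    using ij mid_step_adj[of i] mid_step_adj[of j] wrap[of i] wrap[of j] adj_sym by metis+
  then have key: "\<exists>i d. 2 \<le> d \<and> d + 2 \<le> k \<and> adj (m i) (m (i + d))"
    using ij(1,2)
  proof (induction i j rule: linorder_wlog)
    case (le i j)
    have "i \<noteq> j" using le adj_irrefl by auto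
    moreover have "j \<noteq> Suc i" using le by auto
    moreover have "\<not> (i = 0 \<and> j = k - 1)" using le by auto
    ultimately show ?case
      using le by (intro exI[of _ i] exI[of _ "j - i"]) auto
  next
    case (sym i j)
    then show ?case using adj_sym by metis
  qed
  then show thesis using that by blast
qed

text \<open>The chord of the midpoint cycle is the edge \<open>x y\<close> of
  \<open>double_broom\<close>; the private neighbours are the hole vertices that the two midpoints
  join. The assumption \<open>rule\<close> records that midpoints are taken from \<open>D\<close>
  when possible.\<close>

lemma no_eds:
  assumes D: "eds G D" and adm: "\<And>i. s i \<in> admissible G"
    and rule: "\<And>i d. d \<in> D \<Longrightarrow> d \<in> N (s i) \<Longrightarrow> d \<in> N (s (Suc i)) \<Longrightarrow> d = m i"
  shows False
proof -
  obtain i d where d: "2 \<le> d" "d + 2 \<le> k" "adj (m i) (m (i + d))" by (rule mid_chord)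
  define j where "j = i + d"
  have n: "\<not> adj c z" if "z \<notin> N c" "z \<in> V" "c \<in> V" for c z
    using that adj_sym by (auto simp: in_N)
  \<comment> \<open>Continuing around the hole from \<open>s j\<close>, the midpoint
    \<open>m i\<close> reappears as \<open>m (j + (k - d))\<close>.\<close>
  have "m i \<notin> N (s j)"
    using mid_notin[of "k - d" j] d period(2)[of i] by (simp add: j_def)
  moreover have "m i \<notin> N (s (Suc j))"
    using mid_notin[of "k - Suc d" "Suc j"] d period(2)[of i] by (simp add: j_def)
  moreover have "m j \<notin> N (s i)" "m j \<notin> N (s (Suc i))"
    using mid_notin[of d i] mid_notin[of "d - 1" "Suc i"] d by (simp_all add: j_def)
  ultimately have nn: "\<not> adj (s j) (m i)" "\<not> adj (s (Suc j)) (m i)" "\<not> adj (s i) (m j)" "\<not> adj (s (Suc i)) (m j)"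
    using n sV mV by auto
  have ind: "\<not> adj (s i) (s j)" "\<not> adj (s i) (s (Suc j))" "\<not> adj (s (Suc i)) (s j)" "\<not> adj (s (Suc i)) (s (Suc j))"
    using independent[of d i] independent[of "Suc d" i] independent[of "d - 1" "Suc i"]
      independent[of d "Suc i"] d by (simp_all add: j_def)
  show False
    using double_broom[OF D d(3)[folded j_def], of "s i" "s (Suc i)" "s j" "s (Suc j)"]
      mid_adj(1)[of i] mid_adj(1)[of j] mid_adj'[of i] mid_adj'[of j] step_neq no_step_adj[of i] no_step_adj[of j]
      nn ind adm rule adj_sym by (metis Suc_eq_plus1)
qed

end

context chordal_S123_free
begin

theorem square_hole_free:
  assumes D: "eds G D"
  shows "hole_free (\<lambda>u v. u \<noteq> v \<and> near G u v) (admissible G)"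
  unfolding hole_free_def
proof (intro allI notI)
  fix k f assume h: "hole (\<lambda>u v. u \<noteq> v \<and> near G u v) (admissible G) k f"
  define s where "s i = f (i mod k)" for i
  define P where "P i z \<longleftrightarrow> z \<in> N (s i) \<and> z \<in> N (s (Suc i))" for i z
  \<comment> \<open>Since members of \<open>D\<close> satisfying \<open>P i\<close> are near each
    other, there is at most one; preferring it gives \<open>mD\<close>.\<close>
  define m where "m i = (if \<exists>d\<in>D. P i d then SOME d. d \<in> D \<and> P i d else SOME z. P i z)" for i
  have k: "4 \<le> k" using h by (simp add: hole_def)
  have R: "s i \<noteq> s j \<and> near G (s i) (s j) \<longleftrightarrow> j mod k = Suc i mod k \<or> i mod k = Suc j mod k" for i j
    using h k by (simp add: hole_def s_def mod_Suc_eq)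
  have eq: "s i = s j \<longleftrightarrow> i mod k = j mod k" for i j
    using h k by (auto simp: hole_def s_def inj_on_def)
  have adm: "s i \<in> admissible G" for i
    using h k by (auto simp: hole_def s_def)
  have sP: "s (i + k) = s i" for i by (simp add: s_def)
  have ex: "\<exists>z. P i z" for i
    using R[of i "Suc i"] by (auto simp: near_def P_def)
  have mP: "P i (m i)" for i
    using someI_ex[of "\<lambda>d. d \<in> D \<and> P i d"] someI_ex[OF ex[of i]] by (auto simp: m_def)
  have mD: "d = m i" if "d \<in> D" "P i d" for d i
  proof -
    have "m i \<in> D \<and> P i (m i)"
      using that someI_ex[of "\<lambda>d. d \<in> D \<and> P i d"] by (auto simp: m_def)
    moreover have "s i \<in> V" using adm[of i] by (simp add: admissible_def)
    ultimately have "near G d (m i)"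
      using that closed_nbhd_sym[of _ G "s i"] by (auto simp: P_def near_def)
    then show ?thesis using eds_near_eq[OF D] that \<open>m i \<in> D \<and> P i (m i)\<close> by blast
  qed
  have nd: "\<not> k dvd e" if "0 < e" "e < k" for e
    using that nat_dvd_not_less by blast
  interpret square_hole G k s m
  proof
    show "4 \<le> k" by (rule k)
    show "s (i + k) = s i" for i by (rule sP)
    show "m (i + k) = m i" for i
    proof -
      have "P (i + k) = P i" using sP[of i] sP[of "Suc i"] by (simp add: P_def fun_eq_iff)
      then show ?thesis by (simp only: m_def)
    qed
    show "s i \<in> V" for i using adm[of i] by (simp add: admissible_def)
    show "m i \<in> N (s i)" "m i \<in> N (s (Suc i))" for i using mP[of i] by (simp_all add: P_def)
    show "s i \<noteq> s (Suc i)" for i using R[of i "Suc i"] by blast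
    show "\<not> near G (s i) (s (i + d))" if "2 \<le> d" "d + 2 \<le> k" for i d
    proof -
      have "(i + d) mod k \<noteq> i mod k" "(i + d) mod k \<noteq> Suc i mod k" "Suc (i + d) mod k \<noteq> i mod k"
        using nd[of d] nd[of "d - 1"] nd[of "Suc d"] that by (auto simp: mod_eq_dvd_iff_nat)
      then show ?thesis using R[of i "i + d"] eq[of i "i + d"] by metis
    qed
  qed
  show False
    by (rule no_eds[OF D adm]) (use mD in \<open>auto simp: P_def\<close>)
qed

end


section \<open>Packings of maximum weight\<close>

definition packing :: "('a \<Rightarrow> 'a \<Rightarrow> bool) \<Rightarrow> 'a set \<Rightarrow> bool" where
  "packing q J \<longleftrightarrow> (\<forall>u\<in>J. \<forall>v\<in>J. q u v \<longrightarrow> u = v)"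

text \<open>Only vertices of positive weight compete, so every member of \<open>I\<close> is known
  to be admissible and of finite weight once the values of all other vertices are 0.\<close>

definition max_packing :: "('a \<Rightarrow> 'a \<Rightarrow> bool) \<Rightarrow> ('a \<Rightarrow> nat) \<Rightarrow> 'a set \<Rightarrow> 'a set \<Rightarrow> bool" where
  "max_packing q w V I \<longleftrightarrow> I \<subseteq> {v \<in> V. 0 < w v} \<and> packing q I \<and>
     (\<forall>J\<subseteq>{v \<in> V. 0 < w v}. packing q J \<longrightarrow> sum w J \<le> sum w I)"

lemma packing_subset: "packing q J \<Longrightarrow> I \<subseteq> J \<Longrightarrow> packing q I"
  unfolding packing_def by blast

text \<open>
  The weight splits into \<open>w x\<close> on the clique of neighbours of \<open>x\<close> and the rest \<open>w'\<close>. A packing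
  meets the clique at most once, and the constructed one meets it exactly once.
\<close>

lemma max_packing_local_ratio:
  fixes w w' :: "'a \<Rightarrow> nat"
  assumes fin: "finite V" and sym: "\<And>u v. q u v \<Longrightarrow> q v u" and x: "x \<in> V" "0 < w x" "q x x"
    and clique: "\<And>y z. y \<in> V \<Longrightarrow> z \<in> V \<Longrightarrow> 0 < w y \<Longrightarrow> 0 < w z \<Longrightarrow> q x y \<Longrightarrow> q x z \<Longrightarrow> q y z"
    and w': "\<And>y. y \<in> V \<Longrightarrow> w' y = (if q x y then w y - w x else w y)"
    and I: "max_packing q w' V I"
  shows "max_packing q w V (if \<exists>y\<in>I. q x y then I else insert x I)"
proof -
  have supp: "0 < w y" if "y \<in> V" "0 < w' y" for y
    using that w' by (auto split: if_splits)
  have IV: "I \<subseteq> V" "\<And>y. y \<in> I \<Longrightarrow> 0 < w' y" and pI: "packing q I"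
    using I by (auto simp: max_packing_def)
  have finI: "finite I" using IV fin finite_subset by blast
  have upper: "sum w J \<le> w x + sum w' I" if J: "J \<subseteq> {v \<in> V. 0 < w v}" "packing q J" for J
  proof -
    have JV: "J \<subseteq> V" "\<And>y. y \<in> J \<Longrightarrow> 0 < w y" using J by auto
    have finJ: "finite J" using finite_subset[OF JV(1) fin] .
    define K where "K = {y \<in> J. q x y}"
    have "y = z" if "y \<in> K" "z \<in> K" for y z
    proof -
      have "q y z" by (rule clique) (use that JV in \<open>auto simp: K_def\<close>)
      then show ?thesis using that J(2) by (simp add: packing_def K_def)
    qed
    then have "\<exists>y. K \<subseteq> {y}" by blast
    \<comment> \<open>For the at most one vertex of \<open>K\<close>, truncated subtraction still
      satisfies \<open>w y \<le> w x + (w y - w x)\<close>.\<close>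
    then have "sum w K \<le> w x + sum w' K"
    proof
      fix y assume "K \<subseteq> {y}"
      then consider "K = {}" | "K = {y}" by blast
      then show ?thesis
      proof cases
        case 2
        then have "y \<in> V" "q x y" using J by (auto simp: K_def)
        with 2 show ?thesis using w' by simp
      qed simp
    qed
    moreover have "sum w (J - K) = sum w' (J - K)"
      using J w' by (intro sum.cong) (auto simp: K_def)
    moreover have "sum w J = sum w K + sum w (J - K)" "sum w' J = sum w' K + sum w' (J - K)"
      using finJ by (simp_all add: K_def sum.subset_diff[of K J, unfolded K_def] add.commute)
    moreover have "sum w' J \<le> sum w' I"
    proof -
      have "sum w' J = sum w' {y \<in> J. 0 < w' y}"
        using finJ by (intro sum.mono_neutral_right) auto
      also have "\<dots> \<le> sum w' I"
      proof -
        have "packing q {y \<in> J. 0 < w' y}" using J(2) by (rule packing_subset) auto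
        moreover have "{y \<in> J. 0 < w' y} \<subseteq> {v \<in> V. 0 < w' v}" using JV by blast
        ultimately show ?thesis using I by (simp add: max_packing_def)
      qed
      finally show ?thesis .
    qed
    ultimately show ?thesis by linarith
  qed
  show ?thesis
  proof (cases "\<exists>y\<in>I. q x y")
    case True
    then obtain y where y: "y \<in> I" "q x y" by blast
    have only: "z = y" if "z \<in> I" "q x z" for z
    proof -
      have "q z y" by (rule clique) (use that y IV supp in auto)
      then show ?thesis using that y pI by (simp add: packing_def)
    qed
    have "sum w (I - {y}) = sum w' (I - {y})"
    proof (rule sum.cong)
      fix z assume z: "z \<in> I - {y}"
      then have "\<not> q x z" "z \<in> V" using only IV by auto
      then show "w z = w' z" using w' by simp
    qed simp
    \<comment> \<open>Here \<open>0 < w' y\<close> shows that the subtraction was not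
      truncated.\<close>
    moreover have "w y = w x + w' y"
    proof -
      have "y \<in> V" "0 < w' y" using IV y by auto
      then show ?thesis using w'[of y] y by simp
    qed
    ultimately have "sum w I = w x + sum w' I"
      using y finI by (simp add: sum.remove[of I y])
    then show ?thesis
      using True upper IV supp pI by (auto simp: max_packing_def)
  next
    \<comment> \<open>No member of \<open>I\<close> is in the clique, so \<open>w\<close> and
      \<open>w'\<close> agree on \<open>I\<close>, and adding \<open>x\<close> gains exactly
      \<open>w x\<close>.\<close>
    case False
    have "x \<notin> I" using False x by auto
    moreover have "sum w I = sum w' I"
      using False w' IV by (intro sum.cong) auto
    ultimately have "sum w (insert x I) = w x + sum w' I"
      using finI by simp
    moreover have "packing q (insert x I)"
      using pI False sym unfolding packing_def by blast
    ultimately show ?thesis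
      using False upper IV supp x by (auto simp: max_packing_def)
  qed
qed


section \<open>Programs with bounded loops\<close>

text \<open>
  \<open>PFor x p\<close> runs \<open>p\<close> with cell 0 of \<open>x\<close> equal to \<open>0, \<dots>, n - 1\<close>, where \<open>n\<close> is cell 0 of the array
  \<open>''n''\<close>. A well-formed program never writes to that array, which makes \<open>run\<close> a total function
  and bounds the running time by a polynomial in \<open>n\<close> read off the syntax.
\<close>

datatype prog =
    PSkip
  | PAsg string aexp aexp
  | PSeq prog prog
  | PIf bexp prog prog
  | PFor string prog

abbreviation Var :: "string \<Rightarrow> aexp" where
  "Var x \<equiv> Cell x (Const 0)"

primrec code :: "prog \<Rightarrow> com" where
  "code PSkip = Skip"
| "code (PAsg x a b) = Assign x a b"
| "code (PSeq p q) = Seq (code p) (code q)"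
| "code (PIf b p q) = If b (code p) (code q)"
| "code (PFor x p) = Seq (Assign x (Const 0) (Const 0))
     (While (Less (Var x) (Var ''n'')) (Seq (code p) (Assign x (Const 0) (Plus (Var x) (Const 1)))))"

definition set0 :: "store \<Rightarrow> string \<Rightarrow> nat \<Rightarrow> store" where
  "set0 s x v = s(x := (s x)(0 := v))"

lemma set0_simps [simp]:
  "set0 s x v y = (if x = y then (s x)(0 := v) else s y)"
  "set0 (set0 s x v) x v' = set0 s x v'"
  by (auto simp: set0_def)

primrec loop :: "(nat \<Rightarrow> store \<Rightarrow> store) \<Rightarrow> nat \<Rightarrow> store \<Rightarrow> store" where
  "loop f 0 s = s"
| "loop f (Suc k) s = f k (loop f k s)"

primrec run :: "prog \<Rightarrow> store \<Rightarrow> store" where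
  "run PSkip s = s"
| "run (PAsg x a b) s = s(x := (s x)(aval a s := aval b s))"
| "run (PSeq p q) s = run q (run p s)"
| "run (PIf b p q) s = (if bval b s then run p s else run q s)"
| "run (PFor x p) s = set0 (loop (\<lambda>k s. run p (set0 s x k)) (s ''n'' 0) s) x (s ''n'' 0)"

primrec writes :: "prog \<Rightarrow> string set" where
  "writes PSkip = {}"
| "writes (PAsg x a b) = {x}"
| "writes (PSeq p q) = writes p \<union> writes q"
| "writes (PIf b p q) = writes p \<union> writes q"
| "writes (PFor x p) = insert x (writes p)"

primrec wf_prog :: "prog \<Rightarrow> bool" where
  "wf_prog PSkip \<longleftrightarrow> True"
| "wf_prog (PAsg x a b) \<longleftrightarrow> x \<noteq> ''n''"
| "wf_prog (PSeq p q) \<longleftrightarrow> wf_prog p \<and> wf_prog q"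
| "wf_prog (PIf b p q) \<longleftrightarrow> wf_prog p \<and> wf_prog q"
| "wf_prog (PFor x p) \<longleftrightarrow> x \<noteq> ''n'' \<and> x \<notin> writes p \<and> wf_prog p"

text \<open>In \<open>PFor\<close> the constant 2 pays for the initialization and the failing last
  test, and the 2 per round for the test and the increment. \<open>PIf\<close> charges both branches
  to stay a polynomial.\<close>

primrec cost :: "prog \<Rightarrow> nat poly" where
  "cost PSkip = 1"
| "cost (PAsg x a b) = 1"
| "cost (PSeq p q) = cost p + cost q"
| "cost (PIf b p q) = 1 + cost p + cost q"
| "cost (PFor x p) = [:2:] + [:0, 1:] * (cost p + [:2:])"

lemma wf_prog_n: "wf_prog p \<Longrightarrow> ''n'' \<notin> writes p"
  by (induction p) auto

lemma run_frame: "y \<notin> writes p \<Longrightarrow> run p s y = s y"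
proof (induction p arbitrary: s)
  case (PFor x p)
  have "loop (\<lambda>k s. run p (set0 s x k)) k s y = s y" for k
    using PFor by (induction k) auto
  then show ?case using PFor by auto
qed auto

lemma exec_code:
  "wf_prog p \<Longrightarrow> \<exists>t. exec (code p) s t (run p s) \<and> t \<le> poly (cost p) (s ''n'' 0)"
proof (induction p arbitrary: s)
  case (PSeq p q)
  from PSeq.prems have wf: "wf_prog p" "wf_prog q" by auto
  obtain t1 where t1: "exec (code p) s t1 (run p s)" "t1 \<le> poly (cost p) (s ''n'' 0)"
    using PSeq.IH(1)[OF wf(1)] by blast
  obtain t2 where t2: "exec (code q) (run p s) t2 (run q (run p s))" "t2 \<le> poly (cost q) (run p s ''n'' 0)"
    using PSeq.IH(2)[OF wf(2)] by blast
  have "run p s ''n'' = s ''n''" using run_frame wf_prog_n[OF wf(1)] by blast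
  with t1 t2 show ?case by (auto intro!: exI[of _ "t1 + t2"] exec.Seq)
next
  case (PIf b p q)
  show ?case
  proof (cases "bval b s")
    case True
    obtain t where "exec (code p) s t (run p s)" "t \<le> poly (cost p) (s ''n'' 0)"
      using PIf by force
    then show ?thesis using True by (auto intro!: exI[of _ "1 + t"] exec.IfTrue[simplified])
  next
    case False
    obtain t where "exec (code q) s t (run q s)" "t \<le> poly (cost q) (s ''n'' 0)"
      using PIf by force
    then show ?thesis using False by (auto intro!: exI[of _ "1 + t"] exec.IfFalse[simplified])
  qed
next
  case (PFor x p)
  from PFor.prems have wf: "x \<noteq> ''n''" "x \<notin> writes p" "wf_prog p" by auto
  define n where "n = s ''n'' 0"
  define c where "c = poly (cost p) n"
  define st where "st k = loop (\<lambda>k s. run p (set0 s x k)) k s" for k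
  have st_n: "st k ''n'' 0 = n" for k
    using wf wf_prog_n[OF wf(3)] run_frame[of "''n''" p] by (induction k) (auto simp: st_def n_def)
  let ?w = "While (Less (Var x) (Var ''n'')) (Seq (code p) (Assign x (Const 0) (Plus (Var x) (Const 1))))"
  \<comment> \<open>Induction on the number of rounds left. The counter is set separately because
    \<open>st k\<close> still holds its value from the round before.\<close>
  have while: "\<exists>t. exec ?w (set0 (st k) x k) t (set0 (st n) x n) \<and> t \<le> 1 + (n - k) * (c + 2)" if "k \<le> n" for k
    using that
  proof (induction k rule: inc_induct)
    case base
    have "\<not> bval (Less (Var x) (Var ''n'')) (set0 (st n) x n)" using st_n wf by simp
    then show ?case using exec.WhileFalse by fastforce
  next
    case (step k)
    let ?s = "set0 (st k) x k"
    have "?s ''n'' 0 = n" using st_n wf by simp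
    then obtain t1 where t1: "exec (code p) ?s t1 (run p ?s)" "t1 \<le> c"
      using PFor.IH[OF wf(3), of ?s] unfolding c_def by metis
    obtain t2 where t2: "exec ?w (set0 (st (Suc k)) x (Suc k)) t2 (set0 (st n) x n)" "t2 \<le> 1 + (n - Suc k) * (c + 2)"
      using step by blast
    have suc: "run p ?s = st (Suc k)" by (simp add: st_def)
    have "run p ?s x 0 = k" using run_frame[OF wf(2), of ?s] by simp
    then have upd: "set0 (st (Suc k)) x (Suc k) = (run p ?s)(x := (run p ?s x)(aval (Const 0) (run p ?s) := aval (Plus (Var x) (Const 1)) (run p ?s)))"
      unfolding suc by (simp add: set0_def[of "st (Suc k)"])
    have "exec ?w ?s (1 + (t1 + 1) + t2) (set0 (st n) x n)"
    proof (rule exec.WhileTrue)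
      show "bval (Less (Var x) (Var ''n'')) ?s" using st_n wf step by simp
      show "exec (Seq (code p) (Assign x (Const 0) (Plus (Var x) (Const 1)))) ?s (t1 + 1) (set0 (st (Suc k)) x (Suc k))"
        unfolding upd by (rule exec.Seq[OF t1(1) exec.Assign])
    qed (rule t2(1))
    moreover have "1 + (t1 + 1) + t2 \<le> 1 + (n - k) * (c + 2)"
    proof -
      have "n - k = Suc (n - Suc k)" using step by simp
      then show ?thesis using t1 t2 by simp
    qed
    ultimately show ?case by blast
  qed
  obtain t where t: "exec ?w (set0 s x 0) t (set0 (st n) x n)" "t \<le> 1 + n * (c + 2)"
    using while[of 0] by (auto simp: st_def)
  have "exec (code (PFor x p)) s (1 + t) (run (PFor x p) s)"
    using exec.Seq[OF exec.Assign[of x "Const 0" "Const 0" s]] t(1)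
    by (simp add: set0_def st_def n_def)
  moreover have "1 + t \<le> poly (cost (PFor x p)) n"
    using t(2) by (simp add: c_def)
  ultimately show ?case unfolding n_def by blast
qed (auto intro: exec.Skip exec.Assign)

text \<open>Loop invariant rule; the invariant speaks of the store before the counter is set for
  round \<open>k\<close>.\<close>

lemma run_For_induct:
  assumes "I 0 s" and "\<And>k s'. k < s ''n'' 0 \<Longrightarrow> I k s' \<Longrightarrow> I (Suc k) (run p (set0 s' x k))"
  obtains s' where "I (s ''n'' 0) s'" "run (PFor x p) s = set0 s' x (s ''n'' 0)"
proof -
  have "I k (loop (\<lambda>k s. run p (set0 s x k)) k s)" if "k \<le> s ''n'' 0" for k
    using that assms by (induction k) auto
  from this[of "s ''n'' 0"] that show thesis by simp
qed

section \<open>Nested loops that compute sums\<close>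

primrec avars :: "aexp \<Rightarrow> string set" where
  "avars (Const n) = {}"
| "avars (Cell x a) = insert x (avars a)"
| "avars (Plus a b) = avars a \<union> avars b"
| "avars (Minus a b) = avars a \<union> avars b"

primrec bvars :: "bexp \<Rightarrow> string set" where
  "bvars (Less a b) = avars a \<union> avars b"
| "bvars (Not b) = bvars b"
| "bvars (And b c) = bvars b \<union> bvars c"

lemma aval_cong: "(\<And>x. x \<in> avars a \<Longrightarrow> s x = s' x) \<Longrightarrow> aval a s = aval a s'"
  by (induction a) auto

lemma bval_cong: "(\<And>x. x \<in> bvars b \<Longrightarrow> s x = s' x) \<Longrightarrow> bval b s = bval b s'"
proof (induction b)
  case (Less a b)
  then show ?case using aval_cong[of a s s'] aval_cong[of b s s'] by simp
qed auto

text \<open>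
  Nearly all loops of the algorithm have the form \<open>addloop\<close>: for all values of the loop variables
  \<open>zs\<close>, if \<open>b\<close> holds, add \<open>e\<close> to cell \<open>i\<close> of \<open>A\<close>. Since \<open>A\<close> is not read, the result is a plain sum.
\<close>

primrec addloop :: "string list \<Rightarrow> bexp \<Rightarrow> string \<Rightarrow> aexp \<Rightarrow> aexp \<Rightarrow> prog" where
  "addloop [] b A i e = PIf b (PAsg A i (Plus (Cell A i) e)) PSkip"
| "addloop (z # zs) b A i e = PFor z (addloop zs b A i e)"

primrec contrib :: "string list \<Rightarrow> bexp \<Rightarrow> aexp \<Rightarrow> aexp \<Rightarrow> store \<Rightarrow> nat \<Rightarrow> nat" where
  "contrib [] b i e s j = (if bval b s \<and> j = aval i s then aval e s else 0)"
| "contrib (z # zs) b i e s j = (\<Sum>k<s ''n'' 0. contrib zs b i e (set0 s z k) j)"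

text \<open>Cell 0 of a loop variable is overwritten before it is read, so the stores may differ
  there. This absorbs the counter values left over by earlier rounds.\<close>

lemma contrib_cong:
  assumes "\<And>y. y \<in> insert ''n'' (bvars b \<union> avars i \<union> avars e) \<Longrightarrow> y \<notin> set zs \<Longrightarrow> s y = s' y"
    and "\<And>y j. y \<in> set zs \<Longrightarrow> j \<noteq> 0 \<Longrightarrow> s y j = s' y j" and "''n'' \<notin> set zs"
  shows "contrib zs b i e s j = contrib zs b i e s' j"
  using assms
proof (induction zs arbitrary: s s')
  case Nil
  have "bval b s = bval b s'" using Nil by (intro bval_cong) auto
  moreover have "aval i s = aval i s'" "aval e s = aval e s'" using Nil by (auto intro!: aval_cong)
  ultimately show ?case by simp
next
  case (Cons z zs)
  have "contrib zs b i e (set0 s z k) j = contrib zs b i e (set0 s' z k) j" for k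
  proof (rule Cons.IH)
    show "set0 s z k y = set0 s' z k y" if "y \<in> insert ''n'' (bvars b \<union> avars i \<union> avars e)" "y \<notin> set zs" for y
      using Cons.prems(1)[of y] Cons.prems(2)[of z] that by (cases "y = z") (auto simp: fun_eq_iff)
    show "set0 s z k y j' = set0 s' z k y j'" if "y \<in> set zs" "j' \<noteq> 0" for y j'
      using Cons.prems(2)[of y j'] that by auto
  qed (use Cons.prems in auto)
  moreover have "s ''n'' = s' ''n''" using Cons.prems by auto
  ultimately show ?case by simp
qed

lemma writes_addloop: "writes (addloop zs b A i e) = insert A (set zs)"
  by (induction zs) auto

lemma run_addloop:
  assumes "A \<notin> insert ''n'' (bvars b \<union> avars i \<union> avars e) \<union> set zs" "''n'' \<notin> set zs" "distinct zs"
  shows "run (addloop zs b A i e) s A j = s A j + contrib zs b i e s j"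
    and "y \<noteq> A \<Longrightarrow> j' \<noteq> 0 \<Longrightarrow> run (addloop zs b A i e) s y j' = s y j'"
  using assms
proof (induction zs arbitrary: s j y j')
  case Nil
  {
    case 1
    then show ?case by simp
  next
    case 2
    then show ?case by simp
  }
next
  case (Cons z zs)
  have step: "run (addloop (z # zs) b A i e) s A j = s A j + contrib (z # zs) b i e s j \<and>
      (y \<noteq> A \<longrightarrow> j' \<noteq> 0 \<longrightarrow> run (addloop (z # zs) b A i e) s y j' = s y j')"
    if prems: "A \<notin> insert ''n'' (bvars b \<union> avars i \<union> avars e) \<union> set (z # zs)" "''n'' \<notin> set (z # zs)" "distinct (z # zs)"
    for s j y j'
  proof -
  let ?p = "addloop zs b A i e"
  let ?n = "s ''n'' 0"
  have A: "A \<notin> insert ''n'' (bvars b \<union> avars i \<union> avars e) \<union> set zs" "A \<noteq> z"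
    and z: "''n'' \<notin> set zs" "distinct zs" "z \<notin> set zs" "z \<noteq> ''n''"
    using prems by auto
  define I where "I k s' \<longleftrightarrow> (\<forall>j. s' A j = s A j + (\<Sum>k'<k. contrib zs b i e (set0 s z k') j)) \<and>
      (\<forall>y. y \<notin> insert A (insert z (set zs)) \<longrightarrow> s' y = s y) \<and> (\<forall>y j. y \<noteq> A \<longrightarrow> j \<noteq> 0 \<longrightarrow> s' y j = s y j)" for k s'
  obtain s' where s': "I ?n s'" "run (PFor z ?p) s = set0 s' z ?n"
  proof (rule run_For_induct[of I s ?p z])
    show "I 0 s" by (simp add: I_def)
    show "I (Suc k) (run ?p (set0 s' z k))" if k: "k < ?n" and I: "I k s'" for k s'
    proof -
      have I1: "s' A j = s A j + (\<Sum>k'<k. contrib zs b i e (set0 s z k') j)" for j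
        using I by (simp add: I_def)
      have I2: "s' y = s y" if "y \<notin> insert A (insert z (set zs))" for y
        using I that unfolding I_def by blast
      have I3: "s' y j = s y j" if "y \<noteq> A" "j \<noteq> 0" for y j
        using I that unfolding I_def by blast
      have c: "contrib zs b i e (set0 s' z k) j = contrib zs b i e (set0 s z k) j" for j
      proof (rule contrib_cong)
        show "set0 s' z k y = set0 s z k y" if "y \<in> insert ''n'' (bvars b \<union> avars i \<union> avars e)" "y \<notin> set zs" for y
        proof (cases "y = z")
          case True
          then show ?thesis using I3[of z] A(2) by (auto simp: fun_eq_iff)
        next
          case False
          then show ?thesis using I2[of y] that A(1) by auto
        qed
        show "set0 s' z k y j' = set0 s z k y j'" if "y \<in> set zs" "j' \<noteq> 0" for y j'
          using I3[of y j'] I3[of z j'] A that by auto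
      qed (use z in auto)
      have other: "set0 s' z k A = s' A" using A(2) by simp
      have "run ?p (set0 s' z k) A j = s A j + (\<Sum>k'<Suc k. contrib zs b i e (set0 s z k') j)" for j
        unfolding Cons.IH(1)[OF A(1) z(1,2)] c other I1 by simp
      moreover have "run ?p (set0 s' z k) y = s y" if "y \<notin> insert A (insert z (set zs))" for y
        using run_frame[of y ?p "set0 s' z k"] that I2[of y] by (auto simp: writes_addloop)
      moreover have "run ?p (set0 s' z k) y j' = s y j'" if "y \<noteq> A" "j' \<noteq> 0" for y j'
        unfolding Cons.IH(2)[OF that A(1) z(1,2)] using I3[OF that] that by simp
      ultimately show ?thesis unfolding I_def by blast
    qed
  qed
  show ?thesis using s' A by (auto simp: I_def)
  qed
  {
    case 1
    then show ?case using step by blast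
  next
    case 2
    then show ?case using step by blast
  }
qed

lemma poly_nat_mono: "m \<le> n \<Longrightarrow> poly p m \<le> poly p n" for p :: "nat poly"
  by (induction p) (auto intro!: add_mono mult_mono)


section \<open>The algorithm\<close>

text \<open>
  The cell of \<open>row\<close> with index \<open>u\<close> holds \<open>u * n\<close>, as there is no multiplication. Boolean arrays
  encode truth by positive numbers, except for the output \<open>D\<close>. The array \<open>W\<close> holds the current
  values of the vertices, \<open>ns\<close> marks for each round \<open>t\<close> the vertices that are not simplicial among
  those of positive value, and \<open>ord\<close> and \<open>delta\<close> record the simplicial vertex chosen in round \<open>t\<close>
  and its value. The second phase goes through the rounds backwards, and \<open>cf\<close> marks the rounds
  whose vertex is in conflict with the packing found so far.
\<close>

abbreviation Idx :: "string \<Rightarrow> string \<Rightarrow> aexp" where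
  "Idx x y \<equiv> Plus (Cell ''row'' (Var x)) (Var y)"

abbreviation Pos :: "aexp \<Rightarrow> bexp" where
  "Pos a \<equiv> Less (Const 0) a"

abbreviation Equal :: "aexp \<Rightarrow> aexp \<Rightarrow> bexp" where
  "Equal a b \<equiv> And (Not (Less a b)) (Not (Less b a))"

abbreviation Or :: "bexp \<Rightarrow> bexp \<Rightarrow> bexp" where
  "Or b c \<equiv> Not (And (Not b) (Not c))"

abbreviation Adj :: "string \<Rightarrow> string \<Rightarrow> bexp" where
  "Adj x y \<equiv> Pos (Cell ''adj'' (Idx x y))"

abbreviation Near :: "string \<Rightarrow> string \<Rightarrow> bexp" where
  "Near x y \<equiv> Pos (Cell ''near'' (Idx x y))"

abbreviation Always :: bexp where
  "Always \<equiv> Pos (Const 1)"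

definition row_prog :: prog where
  "row_prog = addloop [''u'', ''v''] (Less (Var ''v'') (Var ''u'')) ''row'' (Var ''u'') (Var ''n'')"

text \<open>After this phase the matrix \<open>adj\<close> is reflexive and encodes closed
  neighbourhoods.\<close>

definition diag_prog :: prog where
  "diag_prog = addloop [''u''] Always ''adj'' (Idx ''u'' ''u'') (Const 1)"

definition near_prog :: prog where
  "near_prog = addloop [''u'', ''v'', ''w''] (And (Adj ''u'' ''w'') (Adj ''v'' ''w'')) ''near'' (Idx ''u'' ''v'') (Const 1)"

text \<open>A cell counts the witnesses \<open>w\<close> for which \<open>v\<close> passes the
  admissibility test at \<open>u\<close>; a zero cell makes \<open>v\<close> bad.\<close>

definition ok_prog :: prog where
  "ok_prog = addloop [''v'', ''u'', ''w'']
     (And (Adj ''u'' ''w'') (Or (Equal (Var ''w'') (Var ''v'')) (Not (Near ''w'' ''v''))))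
     ''ok'' (Idx ''v'' ''u'') (Const 1)"

definition bad_prog :: prog where
  "bad_prog = addloop [''v'', ''u''] (Not (Pos (Cell ''ok'' (Idx ''v'' ''u'')))) ''bad'' (Var ''v'') (Const 1)"

definition big_prog :: prog where
  "big_prog = addloop [''v''] Always ''big'' (Const 0) (Cell ''weight'' (Var ''v''))"

abbreviation Cand :: "string \<Rightarrow> bexp" where
  "Cand x \<equiv> And (Pos (Cell ''weight'' (Var x))) (Not (Pos (Cell ''bad'' (Var x))))"

text \<open>
  A candidate \<open>v\<close> of weight \<open>k\<close> gets the value \<open>|N[v]| * B - k\<close> with \<open>B = big + 1\<close>: the first program
  adds \<open>B\<close> for every proper neighbour, the second one \<open>B - k\<close>, where \<open>weight\<close> holds \<open>k + 1\<close>.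
\<close>

definition value_prog1 :: prog where
  "value_prog1 = addloop [''v'', ''u''] (And (Cand ''v'') (And (Adj ''v'' ''u'') (Not (Equal (Var ''u'') (Var ''v'')))))
     ''W'' (Var ''v'') (Plus (Var ''big'') (Const 1))"

definition value_prog2 :: prog where
  "value_prog2 = addloop [''v''] (Cand ''v'') ''W'' (Var ''v'')
     (Minus (Plus (Var ''big'') (Const 2)) (Cell ''weight'' (Var ''v'')))"

definition flag_prog :: prog where
  "flag_prog = addloop [''u'', ''v'', ''w'']
     (And (And (Pos (Cell ''W'' (Var ''v''))) (Pos (Cell ''W'' (Var ''w''))))
       (And (And (Near ''u'' ''v'') (Near ''u'' ''w'')) (Not (Near ''v'' ''w''))))
     ''ns'' (Idx ''t'' ''u'') (Const 1)"

definition choose_prog :: prog where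
  "choose_prog = PFor ''u'' (PIf (And (Pos (Cell ''W'' (Var ''u''))) (Not (Pos (Cell ''ns'' (Idx ''t'' ''u'')))))
     (PAsg ''ord'' (Var ''t'') (Var ''u'')) PSkip)"

definition delta_prog :: prog where
  "delta_prog = PAsg ''delta'' (Var ''t'') (Cell ''W'' (Cell ''ord'' (Var ''t'')))"

definition reduce_prog :: prog where
  "reduce_prog = PFor ''v'' (PIf (Pos (Cell ''near'' (Plus (Cell ''row'' (Cell ''ord'' (Var ''t''))) (Var ''v''))))
     (PAsg ''W'' (Var ''v'') (Minus (Cell ''W'' (Var ''v'')) (Cell ''delta'' (Var ''t'')))) PSkip)"

definition elim_prog :: prog where
  "elim_prog = PFor ''t'' (PSeq flag_prog (PSeq choose_prog (PSeq delta_prog reduce_prog)))"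

text \<open>Loops only count upwards; this index runs through the rounds from the last to the
  first.\<close>

abbreviation Rev :: aexp where
  "Rev \<equiv> Minus (Var ''n'') (Plus (Var ''t'') (Const 1))"

definition conflict_prog :: prog where
  "conflict_prog = addloop [''v'']
     (And (Pos (Cell ''near'' (Plus (Cell ''row'' (Cell ''ord'' Rev)) (Var ''v'')))) (Equal (Cell ''D'' (Var ''v'')) (Const 1)))
     ''cf'' Rev (Const 1)"

definition pick_prog :: prog where
  "pick_prog = PFor ''t'' (PSeq conflict_prog
     (PIf (And (Pos (Cell ''delta'' Rev)) (Not (Pos (Cell ''cf'' Rev)))) (PAsg ''D'' (Cell ''ord'' Rev) (Const 1)) PSkip))"

definition dom_prog :: prog where
  "dom_prog = addloop [''v'', ''u''] (And (Adj ''v'' ''u'') (Equal (Cell ''D'' (Var ''u'')) (Const 1))) ''dom'' (Var ''v'') (Const 1)"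

definition fail_prog :: prog where
  "fail_prog = addloop [''v''] (Or (Not (Equal (Cell ''dom'' (Var ''v'')) (Const 1)))
     (And (Equal (Cell ''D'' (Var ''v'')) (Const 1)) (Not (Pos (Cell ''weight'' (Var ''v''))))))
     ''fail'' (Const 0) (Const 1)"

definition found_prog :: prog where
  "found_prog = PIf (Pos (Var ''fail'')) PSkip (PAsg ''found'' (Const 0) (Const 1))"

definition wed_prog :: prog where
  "wed_prog = PSeq row_prog (PSeq diag_prog (PSeq near_prog (PSeq ok_prog (PSeq bad_prog (PSeq big_prog
     (PSeq value_prog1 (PSeq value_prog2 (PSeq elim_prog (PSeq pick_prog (PSeq dom_prog (PSeq fail_prog found_prog)))))))))))"

lemmas prog_defs = row_prog_def diag_prog_def near_prog_def ok_prog_def bad_prog_def big_prog_def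
  value_prog1_def value_prog2_def flag_prog_def choose_prog_def delta_prog_def reduce_prog_def
  elim_prog_def conflict_prog_def pick_prog_def dom_prog_def fail_prog_def found_prog_def wed_prog_def

lemma wf_wed_prog: "wf_prog wed_prog"
  by (simp add: prog_defs)

lemma idx_eq_iff: "v < n \<Longrightarrow> v' < n \<Longrightarrow> u * n + v = u' * n + v' \<longleftrightarrow> u = u' \<and> v = v'" for n :: nat
  by (metis div_mult_self3 div_less mod_less mod_mult_self3 not_less_zero add_0 add.commute less_nat_zero_code)

section \<open>Effect of the single phases on the store\<close>

definition prepared :: "nat ugraph \<Rightarrow> (nat \<Rightarrow> enat) \<Rightarrow> nat \<Rightarrow> store \<Rightarrow> bool" where
  "prepared G \<omega> n s \<longleftrightarrow> s ''n'' 0 = n \<and> (\<forall>u<n. s ''row'' u = u * n) \<and>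
     (\<forall>u<n. \<forall>v<n. 0 < s ''adj'' (u * n + v) \<longleftrightarrow> v \<in> closed_nbhd G u) \<and>
     (\<forall>u<n. \<forall>v<n. 0 < s ''near'' (u * n + v) \<longleftrightarrow> near G u v) \<and>
     (\<forall>v<n. s ''weight'' v = weight_code (\<omega> v))"

lemma preparedD:
  assumes "prepared G \<omega> n s"
  shows "s ''n'' 0 = n" "u < n \<Longrightarrow> s ''row'' u = u * n"
    "u < n \<Longrightarrow> v < n \<Longrightarrow> 0 < s ''adj'' (u * n + v) \<longleftrightarrow> v \<in> closed_nbhd G u"
    "u < n \<Longrightarrow> v < n \<Longrightarrow> 0 < s ''near'' (u * n + v) \<longleftrightarrow> near G u v"
    "v < n \<Longrightarrow> s ''weight'' v = weight_code (\<omega> v)"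
  using assms by (auto simp: prepared_def)

lemma prepared_cong:
  assumes "prepared G \<omega> n s" "\<And>y. y \<in> {''n'', ''row'', ''adj'', ''near'', ''weight''} \<Longrightarrow> s' y = s y"
  shows "prepared G \<omega> n s'"
  using assms by (simp add: prepared_def)

text \<open>The support of \<open>contrib\<close> for increment 1. It suffices for marking loops,
  whose counts matter only through being positive.\<close>

primrec hits :: "string list \<Rightarrow> bexp \<Rightarrow> aexp \<Rightarrow> store \<Rightarrow> nat \<Rightarrow> bool" where
  "hits [] b i s j \<longleftrightarrow> bval b s \<and> j = aval i s"
| "hits (z # zs) b i s j \<longleftrightarrow> (\<exists>k<s ''n'' 0. hits zs b i (set0 s z k) j)"

lemma contrib_pos_iff: "0 < contrib zs b i (Const 1) s j \<longleftrightarrow> hits zs b i s j"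
proof (induction zs arbitrary: s)
  case (Cons z zs)
  have "0 < contrib (z # zs) b i (Const 1) s j \<longleftrightarrow> (\<exists>k\<in>{..<s ''n'' 0}. 0 < contrib zs b i (Const 1) (set0 s z k) j)"
    by (simp only: contrib.simps zero_less_iff_neq_zero sum_eq_0_iff finite_lessThan) simp
  then show ?case unfolding Cons.IH by (simp add: Bex_def del: set0_simps contrib.simps)
qed simp

lemma bval_Equal [simp]: "bval (Equal a b) s \<longleftrightarrow> aval a s = aval b s"
  by auto

lemma bval_Or [simp]: "bval (Or b c) s \<longleftrightarrow> bval b s \<or> bval c s"
  by simp

lemma run_mark:
  assumes "A \<notin> insert ''n'' (bvars b \<union> avars i) \<union> set zs" "''n'' \<notin> set zs" "distinct zs"
  shows "0 < run (addloop zs b A i (Const 1)) s A j \<longleftrightarrow> 0 < s A j \<or> hits zs b i s j"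
proof -
  have "run (addloop zs b A i (Const 1)) s A j = s A j + contrib zs b i (Const 1) s j"
    by (rule run_addloop) (use assms in auto)
  then show ?thesis using contrib_pos_iff[of zs b i s j] by linarith
qed

text \<open>Row-major indices are unique, so fixing the target cell fixes the two outer loop
  variables.\<close>

lemma ex_idx:
  fixes n :: nat
  assumes "\<And>u. u < n \<Longrightarrow> r u = u * n" "u < n" "v < n"
  shows "(\<exists>u'<n. \<exists>v'<n. \<exists>w<n. P u' v' w \<and> u * n + v = r u' + v') \<longleftrightarrow> (\<exists>w<n. P u v w)" (is "?l \<longleftrightarrow> ?r")
proof
  assume ?l
  then obtain u' v' w where *: "u' < n" "v' < n" "w < n" "P u' v' w" "u * n + v = u' * n + v'"
    using assms(1) by force
  then have "u = u'" "v = v'" using idx_eq_iff[OF assms(3) *(2), of u u'] by simp_all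
  then show ?r using * by blast
next
  assume ?r
  then show ?l using assms by metis
qed

lemma writes_progs:
  "writes row_prog = {''row'', ''u'', ''v''}" "writes diag_prog = {''adj'', ''u''}"
  "writes near_prog = {''near'', ''u'', ''v'', ''w''}" "writes ok_prog = {''ok'', ''u'', ''v'', ''w''}"
  "writes bad_prog = {''bad'', ''u'', ''v''}" "writes big_prog = {''big'', ''v''}"
  "writes value_prog1 = {''W'', ''u'', ''v''}" "writes value_prog2 = {''W'', ''v''}"
  "writes flag_prog = {''ns'', ''u'', ''v'', ''w''}" "writes choose_prog = {''ord'', ''u''}"
  "writes delta_prog = {''delta''}" "writes reduce_prog = {''W'', ''v''}"
  "writes elim_prog = {''ns'', ''ord'', ''delta'', ''W'', ''t'', ''u'', ''v'', ''w''}"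
  "writes conflict_prog = {''cf'', ''v''}" "writes pick_prog = {''cf'', ''D'', ''t'', ''v''}"
  "writes dom_prog = {''dom'', ''u'', ''v''}" "writes fail_prog = {''fail'', ''v''}"
  "writes found_prog = {''found''}"
  by (auto simp: prog_defs writes_addloop)

lemma run_row:
  assumes "s ''n'' 0 = n" "\<And>i. s ''row'' i = 0"
  shows "u < n \<Longrightarrow> run row_prog s ''row'' u = u * n"
proof -
  assume u: "u < n"
  have "run row_prog s ''row'' u = (\<Sum>u'<n. \<Sum>v<n. if v < u' \<and> u = u' then n else 0)"
    unfolding row_prog_def by (subst run_addloop(1)) (simp_all add: assms cong: if_cong)
  also have "\<dots> = (\<Sum>u'<n. if u' = u then (\<Sum>v<n. if v < u then n else 0) else 0)"
    by (intro sum.cong) auto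
  also have "\<dots> = (\<Sum>v<n. if v < u then n else 0)" using u by simp
  also have "\<dots> = (\<Sum>v<u. n)"
    using u by (intro sum.mono_neutral_cong_right) auto
  finally show ?thesis by simp
qed

lemma run_diag:
  assumes "s ''n'' 0 = n" "\<And>u. u < n \<Longrightarrow> s ''row'' u = u * n" and "u < n" "v < n"
  shows "0 < run diag_prog s ''adj'' (u * n + v) \<longleftrightarrow> u = v \<or> 0 < s ''adj'' (u * n + v)"
proof -
  have "0 < run diag_prog s ''adj'' (u * n + v) \<longleftrightarrow> 0 < s ''adj'' (u * n + v) \<or> (\<exists>u'<n. u * n + v = s ''row'' u' + u')"
    unfolding diag_prog_def by (subst run_mark) (simp_all add: assms(1))
  also have "\<dots> \<longleftrightarrow> u = v \<or> 0 < s ''adj'' (u * n + v)"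
    using assms(2-4) idx_eq_iff[OF assms(4)] by fastforce
  finally show ?thesis .
qed

lemma run_near:
  assumes "s ''n'' 0 = n" "\<And>u. u < n \<Longrightarrow> s ''row'' u = u * n" "\<And>i. s ''near'' i = 0" and "u < n" "v < n"
  shows "0 < run near_prog s ''near'' (u * n + v) \<longleftrightarrow> (\<exists>w<n. 0 < s ''adj'' (u * n + w) \<and> 0 < s ''adj'' (v * n + w))"
proof -
  have "0 < run near_prog s ''near'' (u * n + v) \<longleftrightarrow> (\<exists>u'<n. \<exists>v'<n. \<exists>w<n.
      (0 < s ''adj'' (s ''row'' u' + w) \<and> 0 < s ''adj'' (s ''row'' v' + w)) \<and> u * n + v = s ''row'' u' + v')"
    unfolding near_prog_def by (subst run_mark) (simp_all add: assms(1,3))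
  also have "\<dots> \<longleftrightarrow> (\<exists>w<n. 0 < s ''adj'' (s ''row'' u + w) \<and> 0 < s ''adj'' (s ''row'' v + w))"
    by (rule ex_idx[OF assms(2,4,5)])
  finally show ?thesis using assms(2,4,5) by simp
qed

lemma not_less_both: "\<not> a < b \<and> \<not> b < a \<longleftrightarrow> a = b" for a b :: nat
  by auto

lemma run_ok:
  assumes "prepared G \<omega> n s" "\<And>i. s ''ok'' i = 0" and "u < n" "v < n"
  shows "0 < run ok_prog s ''ok'' (v * n + u) \<longleftrightarrow> (\<exists>w<n. w \<in> closed_nbhd G u \<and> (w = v \<or> \<not> near G w v))"
proof -
  note p = preparedD[OF assms(1)]
  have "0 < run ok_prog s ''ok'' (v * n + u) \<longleftrightarrow> (\<exists>v'<n. \<exists>u'<n. \<exists>w<n.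
      (0 < s ''adj'' (s ''row'' u' + w) \<and> (w = v' \<or> \<not> 0 < s ''near'' (s ''row'' w + v'))) \<and> v * n + u = s ''row'' v' + u')"
    unfolding ok_prog_def by (subst run_mark) (simp_all add: assms(2) p(1) not_less_both)
  also have "\<dots> \<longleftrightarrow> (\<exists>w<n. 0 < s ''adj'' (s ''row'' u + w) \<and> (w = v \<or> \<not> 0 < s ''near'' (s ''row'' w + v)))"
    by (rule ex_idx[OF p(2) assms(4,3)])
  also have "\<dots> \<longleftrightarrow> (\<exists>w<n. w \<in> closed_nbhd G u \<and> (w = v \<or> \<not> near G w v))"
    using assms(3,4) by (intro ex_cong1) (simp add: p(2-4) cong: conj_cong)
  finally show ?thesis .
qed

lemma run_bad:
  assumes "prepared G \<omega> n s" "\<And>i. s ''bad'' i = 0" and "v < n"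
  shows "0 < run bad_prog s ''bad'' v \<longleftrightarrow> (\<exists>u<n. s ''ok'' (v * n + u) = 0)"
proof -
  note p = preparedD[OF assms(1)]
  have "0 < run bad_prog s ''bad'' v \<longleftrightarrow> (\<exists>v'<n. \<exists>u<n. s ''ok'' (s ''row'' v' + u) = 0 \<and> v = v')"
    unfolding bad_prog_def by (subst run_mark) (simp_all add: assms(2) p(1))
  also have "\<dots> \<longleftrightarrow> (\<exists>u<n. s ''ok'' (s ''row'' v + u) = 0)" using assms(3) by blast
  finally show ?thesis using p(2)[OF assms(3)] by simp
qed

lemma run_big:
  assumes "s ''n'' 0 = n" "s ''big'' 0 = 0"
  shows "run big_prog s ''big'' 0 = (\<Sum>v<n. s ''weight'' v)"
  unfolding big_prog_def using assms by (subst run_addloop(1)) (simp_all cong: if_cong)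

lemma run_value:
  assumes p: "prepared G \<omega> n s" and "\<And>i. s ''W'' i = 0" and v: "v < n"
    and big: "\<And>v. v < n \<Longrightarrow> s ''weight'' v \<le> s ''big'' 0"
    and N: "closed_nbhd G v \<subseteq> {..<n}" "v \<in> closed_nbhd G v"
  shows "run value_prog2 (run value_prog1 s) ''W'' v =
    (if 0 < s ''weight'' v \<and> s ''bad'' v = 0 then card (closed_nbhd G v) * Suc (s ''big'' 0) - (s ''weight'' v - 1) else 0)"
proof -
  note p = preparedD[OF p]
  define c where "c u \<longleftrightarrow> 0 < s ''weight'' u \<and> s ''bad'' u = 0" for u
  have 1: "run value_prog1 s ''W'' v = (if c v then (card (closed_nbhd G v) - 1) * Suc (s ''big'' 0) else 0)"
  proof -
    have "run value_prog1 s ''W'' v = (\<Sum>v'<n. \<Sum>u<n. if (c v' \<and> 0 < s ''adj'' (s ''row'' v' + u) \<and> u \<noteq> v') \<and> v = v' then Suc (s ''big'' 0) else 0)"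
      unfolding value_prog1_def c_def
      by (subst run_addloop(1)) (auto simp: assms(2) p(1) intro!: sum.cong cong: if_cong)
    also have "\<dots> = (\<Sum>v'<n. if v' = v then (\<Sum>u<n. if c v \<and> 0 < s ''adj'' (s ''row'' v + u) \<and> u \<noteq> v then Suc (s ''big'' 0) else 0) else 0)"
      by (intro sum.cong) auto
    also have "\<dots> = (\<Sum>u<n. if c v \<and> 0 < s ''adj'' (s ''row'' v + u) \<and> u \<noteq> v then Suc (s ''big'' 0) else 0)"
      using v by simp
    also have "\<dots> = (\<Sum>u<n. if c v \<and> u \<in> closed_nbhd G v - {v} then Suc (s ''big'' 0) else 0)"
      using p(2,3) v by (intro sum.cong) auto
    also have "\<dots> = (if c v then (\<Sum>u\<in>closed_nbhd G v - {v}. Suc (s ''big'' 0)) else 0)"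
    proof (cases "c v")
      case True
      have "(\<Sum>u<n. if u \<in> closed_nbhd G v - {v} then Suc (s ''big'' 0) else 0) = (\<Sum>u\<in>closed_nbhd G v - {v}. Suc (s ''big'' 0))"
        using N by (intro sum.mono_neutral_cong_right) auto
      then show ?thesis by (simp only: True simp_thms if_True)
    qed simp
    also have "\<dots> = (if c v then (card (closed_nbhd G v) - 1) * Suc (s ''big'' 0) else 0)"
      using N by simp
    finally show ?thesis .
  qed
  have frame: "y \<notin> {''W'', ''u'', ''v''} \<Longrightarrow> run value_prog1 s y = s y" for y
    by (rule run_frame) (simp add: writes_progs)
  have "run value_prog2 (run value_prog1 s) ''W'' v = run value_prog1 s ''W'' v +
      (\<Sum>v'<n. if c v' \<and> v = v' then s ''big'' 0 + 2 - s ''weight'' v' else 0)"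
    unfolding value_prog2_def c_def
    by (subst run_addloop(1)) (auto simp: frame p(1) intro!: sum.cong cong: if_cong)
  also have "(\<Sum>v'<n. if c v' \<and> v = v' then s ''big'' 0 + 2 - s ''weight'' v' else 0) =
      (\<Sum>v'<n. if v' = v then (if c v then s ''big'' 0 + 2 - s ''weight'' v else 0) else 0)"
    by (intro sum.cong) auto
  also have "\<dots> = (if c v then s ''big'' 0 + 2 - s ''weight'' v else 0)" using v by simp
  finally have 2: "run value_prog2 (run value_prog1 s) ''W'' v = run value_prog1 s ''W'' v + (if c v then s ''big'' 0 + 2 - s ''weight'' v else 0)" .
  \<comment> \<open>Writing the size as \<open>Suc m\<close>, the phases add \<open>m * B\<close>
    and \<open>B - k\<close>; their sum is \<open>Suc m * B - k\<close> because \<open>k\<close> is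
    below \<open>B\<close>.\<close>
  have "card (closed_nbhd G v) \<noteq> 0" using N finite_subset[OF N(1)] by auto
  then obtain m where m: "card (closed_nbhd G v) = Suc m" by (cases "card (closed_nbhd G v)") auto
  show ?thesis
    unfolding 2 1 using big[OF v] m by (auto simp: c_def)
qed

text \<open>Every round has its own row of \<open>ns\<close>, which is still zero when the round
  starts; thus no marks have to be cleared.\<close>

lemma run_flag:
  assumes p: "prepared G \<omega> n s" and "s ''t'' 0 = t" "t < n" "t' < n" "x < n" and z: "s ''ns'' (t' * n + x) = 0"
  shows "0 < run flag_prog s ''ns'' (t' * n + x) \<longleftrightarrow> t' = t \<and>
    (\<exists>v<n. \<exists>w<n. (0 < s ''W'' v \<and> 0 < s ''W'' w) \<and> (near G x v \<and> near G x w) \<and> \<not> near G v w)"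
proof -
  note p = preparedD[OF p]
  have "0 < run flag_prog s ''ns'' (t' * n + x) \<longleftrightarrow> (\<exists>u<n. \<exists>v<n. \<exists>w<n. ((0 < s ''W'' v \<and> 0 < s ''W'' w) \<and>
      (0 < s ''near'' (s ''row'' u + v) \<and> 0 < s ''near'' (s ''row'' u + w)) \<and> \<not> 0 < s ''near'' (s ''row'' v + w)) \<and>
      t' * n + x = s ''row'' t + u)"
    unfolding flag_prog_def by (subst run_mark) (auto simp: z p(1) assms(2))
  also have "\<dots> \<longleftrightarrow> (\<exists>u<n. \<exists>v<n. \<exists>w<n. ((0 < s ''W'' v \<and> 0 < s ''W'' w) \<and> (near G u v \<and> near G u w) \<and> \<not> near G v w) \<and> t' = t \<and> x = u)"
    using p(2,4) assms(3) idx_eq_iff[OF assms(5)] by (intro ex_cong1 conj_cong refl) auto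
  also have "\<dots> \<longleftrightarrow> t' = t \<and>
    (\<exists>v<n. \<exists>w<n. (0 < s ''W'' v \<and> 0 < s ''W'' w) \<and> (near G x v \<and> near G x w) \<and> \<not> near G v w)"
    using assms(5) by blast
  finally show ?thesis .
qed

lemma run_choose:
  assumes "prepared G \<omega> n s" "s ''t'' 0 = t" "t < n" "s ''ord'' t < n"
  defines "C x \<equiv> x < n \<and> 0 < s ''W'' x \<and> s ''ns'' (t * n + x) = 0"
  shows "(\<exists>x. C x) \<Longrightarrow> C (run choose_prog s ''ord'' t)" "run choose_prog s ''ord'' t < n"
    "t' \<noteq> t \<Longrightarrow> run choose_prog s ''ord'' t' = s ''ord'' t'"
proof -
  note p = preparedD[OF assms(1)]
  let ?p = "PIf (And (Pos (Cell ''W'' (Var ''u''))) (Not (Pos (Cell ''ns'' (Idx ''t'' ''u'')))))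
     (PAsg ''ord'' (Var ''t'') (Var ''u'')) PSkip"
  define I where "I k s' \<longleftrightarrow> (\<forall>y. y \<notin> {''ord'', ''u''} \<longrightarrow> s' y = s y) \<and> (\<forall>t'. t' \<noteq> t \<longrightarrow> s' ''ord'' t' = s ''ord'' t') \<and>
      ((\<exists>x<k. C x) \<longrightarrow> C (s' ''ord'' t)) \<and> s' ''ord'' t < n" for k s'
  obtain s' where s': "I (s ''n'' 0) s'" "run (PFor ''u'' ?p) s = set0 s' ''u'' (s ''n'' 0)"
  proof (rule run_For_induct[of I s ?p "''u''"])
    show "I 0 s" using assms(4) by (simp add: I_def)
    fix k s' assume k: "k < s ''n'' 0" and I: "I k s'"
    have f: "s' y = s y" if "y \<notin> {''ord'', ''u''}" for y using I that by (simp add: I_def)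
    have cond: "bval (And (Pos (Cell ''W'' (Var ''u''))) (Not (Pos (Cell ''ns'' (Idx ''t'' ''u''))))) (set0 s' ''u'' k) \<longleftrightarrow> C k"
      using k by (simp add: f p(1,2) assms(2,3) C_def)
    show "I (Suc k) (run ?p (set0 s' ''u'' k))"
    proof (cases "C k")
      case True
      then show ?thesis
        unfolding run.simps cond using I k
        by (auto simp: I_def f assms(2) p(1))
    next
      case False
      then show ?thesis
        unfolding run.simps cond using I by (auto simp: I_def less_Suc_eq)
    qed
  qed
  have "run choose_prog s ''ord'' = s' ''ord''" unfolding choose_prog_def s'(2) by simp
  then show "(\<exists>x. C x) \<Longrightarrow> C (run choose_prog s ''ord'' t)" "run choose_prog s ''ord'' t < n"
    "t' \<noteq> t \<Longrightarrow> run choose_prog s ''ord'' t' = s ''ord'' t'"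
    using s'(1) p(1) by (auto simp: I_def C_def)
qed

lemma run_reduce:
  assumes "prepared G \<omega> n s" "s ''t'' 0 = t" "s ''ord'' t < n" "y < n"
  shows "run reduce_prog s ''W'' y = (if near G (s ''ord'' t) y then s ''W'' y - s ''delta'' t else s ''W'' y)"
proof -
  note p = preparedD[OF assms(1)]
  let ?b = "Pos (Cell ''near'' (Plus (Cell ''row'' (Cell ''ord'' (Var ''t''))) (Var ''v'')))"
  let ?p = "PIf ?b (PAsg ''W'' (Var ''v'') (Minus (Cell ''W'' (Var ''v'')) (Cell ''delta'' (Var ''t'')))) PSkip"
  define I where "I k s' \<longleftrightarrow> (\<forall>y. y \<notin> {''W'', ''v''} \<longrightarrow> s' y = s y) \<and>
      (\<forall>y. s' ''W'' y = (if y < k \<and> near G (s ''ord'' t) y then s ''W'' y - s ''delta'' t else s ''W'' y))" for k s'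
  obtain s' where s': "I (s ''n'' 0) s'" "run (PFor ''v'' ?p) s = set0 s' ''v'' (s ''n'' 0)"
  proof (rule run_For_induct[of I s ?p "''v''"])
    show "I 0 s" by (simp add: I_def)
    fix k s' assume k: "k < s ''n'' 0" and I: "I k s'"
    have f: "s' y = s y" if "y \<notin> {''W'', ''v''}" for y using I that by (simp add: I_def)
    have cond: "bval ?b (set0 s' ''v'' k) \<longleftrightarrow> near G (s ''ord'' t) k"
      using k p(1,2,4) assms(2,3) by (simp add: f)
    show "I (Suc k) (run ?p (set0 s' ''v'' k))"
      unfolding run.simps cond using I by (auto simp: I_def f assms(2) less_Suc_eq)
  qed
  show ?thesis
    unfolding reduce_prog_def s'(2) using s'(1) p(1) assms(4) by (simp add: I_def)
qed

lemma run_conflict: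
  assumes "prepared G \<omega> n s" "s ''t'' 0 = t" "s ''ord'' (n - Suc t) < n" "s ''cf'' (n - Suc t) = 0"
  shows "0 < run conflict_prog s ''cf'' (n - Suc t) \<longleftrightarrow> (\<exists>v<n. near G (s ''ord'' (n - Suc t)) v \<and> s ''D'' v = 1)"
    and "j \<noteq> n - Suc t \<Longrightarrow> s ''cf'' j = 0 \<Longrightarrow> run conflict_prog s ''cf'' j = 0"
proof -
  note p = preparedD[OF assms(1)]
  have *: "0 < run conflict_prog s ''cf'' j \<longleftrightarrow> 0 < s ''cf'' j \<or> (\<exists>v<n. (near G (s ''ord'' (n - Suc t)) v \<and> s ''D'' v = 1) \<and> j = n - Suc t)" for j
    unfolding conflict_prog_def using p(1,2,4) assms(2,3) by (subst run_mark) (auto simp: le_antisym)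
  show "0 < run conflict_prog s ''cf'' (n - Suc t) \<longleftrightarrow> (\<exists>v<n. near G (s ''ord'' (n - Suc t)) v \<and> s ''D'' v = 1)"
    using *[of "n - Suc t"] assms(4) by simp
  show "run conflict_prog s ''cf'' j = 0" if "j \<noteq> n - Suc t" "s ''cf'' j = 0"
    using *[of j] that by simp
qed

lemma run_dom:
  assumes "prepared G \<omega> n s" "\<And>i. s ''dom'' i = 0" "v < n" "closed_nbhd G v \<subseteq> {..<n}"
  shows "run dom_prog s ''dom'' v = card ({u. u < n \<and> s ''D'' u = 1} \<inter> closed_nbhd G v)"
proof -
  note p = preparedD[OF assms(1)]
  have "run dom_prog s ''dom'' v = (\<Sum>v'<n. \<Sum>u<n. if (0 < s ''adj'' (s ''row'' v' + u) \<and> s ''D'' u = 1) \<and> v = v' then 1 else 0)"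
    unfolding dom_prog_def
    by (subst run_addloop(1)) (auto simp: assms(2) p(1) intro!: sum.cong cong: if_cong)
  also have "\<dots> = (\<Sum>v'<n. if v' = v then (\<Sum>u<n. if 0 < s ''adj'' (s ''row'' v + u) \<and> s ''D'' u = 1 then 1 else 0) else 0)"
    by (intro sum.cong) auto
  also have "\<dots> = (\<Sum>u<n. if 0 < s ''adj'' (s ''row'' v + u) \<and> s ''D'' u = 1 then 1 else 0)"
    using assms(3) by simp
  also have "\<dots> = (\<Sum>u\<in>{u. u < n \<and> s ''D'' u = 1} \<inter> closed_nbhd G v. 1)"
    using p(2,3) assms(3,4) by (intro sum.mono_neutral_cong_right) auto
  finally show ?thesis by simp
qed

lemma run_fail:
  assumes "prepared G \<omega> n s" "s ''fail'' 0 = 0"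
  shows "0 < run fail_prog s ''fail'' 0 \<longleftrightarrow> (\<exists>v<n. s ''dom'' v \<noteq> 1 \<or> s ''D'' v = 1 \<and> \<omega> v = \<infinity>)"
proof -
  note p = preparedD[OF assms(1)]
  have w: "v < n \<Longrightarrow> s ''weight'' v = 0 \<longleftrightarrow> \<omega> v = \<infinity>" for v
    using p(5)[of v] by (auto simp: weight_code_def split: enat.splits)
  have "0 < run fail_prog s ''fail'' 0 \<longleftrightarrow> (\<exists>v<n. s ''dom'' v \<noteq> 1 \<or> s ''D'' v = 1 \<and> s ''weight'' v = 0)"
    unfolding fail_prog_def using p(1) assms(2) by (subst run_mark) auto
  then show ?thesis using w by auto
qed


section \<open>Correctness\<close>

lemma eds_sum_card:
  assumes G: "simple_graph G" and D: "eds G D"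
  shows "(\<Sum>v\<in>D. card (closed_nbhd G v)) = card (verts G)"
proof -
  have fin: "finite (verts G)" using G by (simp add: simple_graph_def)
  have sub: "closed_nbhd G v \<subseteq> verts G" for v by (auto simp: closed_nbhd_def)
  have "verts G = (\<Union>v\<in>D. closed_nbhd G v)"
  proof
    show "verts G \<subseteq> (\<Union>v\<in>D. closed_nbhd G v)"
      using eds_dominator[OF D] closed_nbhd_sym by (metis UN_I subsetI)
  qed (use sub in auto)
  moreover have "card (\<Union>v\<in>D. closed_nbhd G v) = (\<Sum>v\<in>D. card (closed_nbhd G v))"
  proof (rule card_UN_disjoint)
    show "finite D" using D fin finite_subset by (auto simp: eds_def)
    show "\<forall>v\<in>D. finite (closed_nbhd G v)" using sub fin finite_subset by blast
    show "\<forall>u\<in>D. \<forall>v\<in>D. u \<noteq> v \<longrightarrow> closed_nbhd G u \<inter> closed_nbhd G v = {}"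
      using eds_near_eq[OF D] by (auto simp: near_def)
  qed
  ultimately show ?thesis by simp
qed

text \<open>The closed neighbourhoods of a packing are disjoint, which gives the bound. Equality
  leaves no vertex uncovered, and disjointness makes each dominator unique.\<close>

lemma packing_sum_card:
  assumes G: "simple_graph G" and D: "D \<subseteq> verts G" "packing (near G) D"
  shows "(\<Sum>v\<in>D. card (closed_nbhd G v)) \<le> card (verts G)"
    and "(\<Sum>v\<in>D. card (closed_nbhd G v)) = card (verts G) \<Longrightarrow> eds G D"
proof -
  have fin: "finite (verts G)" using G by (simp add: simple_graph_def)
  have sub: "closed_nbhd G v \<subseteq> verts G" for v by (auto simp: closed_nbhd_def)
  have U: "(\<Union>v\<in>D. closed_nbhd G v) \<subseteq> verts G" using sub by auto
  have *: "card (\<Union>v\<in>D. closed_nbhd G v) = (\<Sum>v\<in>D. card (closed_nbhd G v))"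
  proof (rule card_UN_disjoint)
    show "finite D" using D fin finite_subset by auto
    show "\<forall>v\<in>D. finite (closed_nbhd G v)" using sub fin finite_subset by blast
    show "\<forall>u\<in>D. \<forall>v\<in>D. u \<noteq> v \<longrightarrow> closed_nbhd G u \<inter> closed_nbhd G v = {}"
      using D(2) by (auto simp: packing_def near_def)
  qed
  show "(\<Sum>v\<in>D. card (closed_nbhd G v)) \<le> card (verts G)"
    unfolding *[symmetric] by (rule card_mono[OF fin U])
  assume "(\<Sum>v\<in>D. card (closed_nbhd G v)) = card (verts G)"
  then have all: "(\<Union>v\<in>D. closed_nbhd G v) = verts G"
    using card_subset_eq[OF fin U] * by simp
  have "card (D \<inter> closed_nbhd G v) = 1" if v: "v \<in> verts G" for v
  proof -
    obtain d where d: "d \<in> D" "v \<in> closed_nbhd G d" using v all by blast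
    have "d \<in> closed_nbhd G v" using closed_nbhd_sym[OF d(2)] d D by auto
    moreover have "e = d" if "e \<in> D" "e \<in> closed_nbhd G v" for e
    proof -
      have "v \<in> closed_nbhd G e" using closed_nbhd_sym[OF that(2) v] .
      then have "near G e d" using d by (auto simp: near_def)
      then show ?thesis using D(2) that d by (auto simp: packing_def)
    qed
    ultimately have "D \<inter> closed_nbhd G v = {d}" using d(1) by blast
    then show ?thesis by simp
  qed
  then show "eds G D" using D by (simp add: eds_def)
qed

text \<open>By truncation the weight infinity is sent to 0, so infinite weights add nothing to the
  total that \<open>B\<close> has to exceed.\<close>

definition cost_of :: "enat \<Rightarrow> nat" where
  "cost_of x = weight_code x - 1"

lemma enat_cost_of: "x \<noteq> \<infinity> \<Longrightarrow> enat (cost_of x) = x"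
  by (auto simp: cost_of_def weight_code_def)

lemma sum_enat_cost_of:
  assumes "finite D" "\<And>v. v \<in> D \<Longrightarrow> \<omega> v \<noteq> \<infinity>"
  shows "sum \<omega> D = enat (\<Sum>v\<in>D. cost_of (\<omega> v))"
  using assms by (induction D rule: finite_induct) (auto simp: enat_cost_of zero_enat_def simp flip: plus_enat_simps(1))

lemma sum_infinity: "finite D \<Longrightarrow> v \<in> D \<Longrightarrow> \<omega> v = \<infinity> \<Longrightarrow> sum \<omega> D = (\<infinity> :: enat)"
  by (simp add: sum.remove)

text \<open>
  Each vertex dominated is worth \<open>B\<close>, more than all weights together, so a packing of maximum
  value dominates everything if that is possible at all, and then has minimum weight.
\<close>

lemma max_packing_min_finite_eds:
  assumes G: "simple_graph G" and D0: "eds G D\<^sub>0" "sum \<omega> D\<^sub>0 \<noteq> \<infinity>"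
    and w: "\<And>v. v \<in> verts G \<Longrightarrow> v \<in> admissible G \<Longrightarrow> \<omega> v \<noteq> \<infinity> \<Longrightarrow> w v + cost_of (\<omega> v) = card (closed_nbhd G v) * B"
    and w0: "\<And>v. v \<in> verts G \<Longrightarrow> \<not> (v \<in> admissible G \<and> \<omega> v \<noteq> \<infinity>) \<Longrightarrow> w v = 0"
    and B: "(\<Sum>v\<in>verts G. cost_of (\<omega> v)) < B"
    and I: "max_packing (near G) w (verts G) I"
  shows "min_finite_eds G \<omega> I"
proof -
  let ?n = "card (verts G)"
  let ?c = "\<lambda>D. \<Sum>v\<in>D. card (closed_nbhd G v)"
  let ?k = "\<lambda>D. \<Sum>v\<in>D. cost_of (\<omega> v)"
  have fin: "finite (verts G)" using G by (simp add: simple_graph_def)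
  have kB: "?k D < B" if "D \<subseteq> verts G" for D
    using sum_mono2[OF fin that, of "\<lambda>v. cost_of (\<omega> v)"] B by simp
  have IV: "I \<subseteq> verts G" "packing (near G) I" and Ipos: "\<And>v. v \<in> I \<Longrightarrow> 0 < w v"
    using I by (auto simp: max_packing_def)
  have Icand: "v \<in> admissible G \<and> \<omega> v \<noteq> \<infinity>" if "v \<in> I" for v
    using w0[of v] Ipos[OF that] IV that by fastforce
  have worth: "sum w D + ?k D = ?c D * B" if "D \<subseteq> verts G" "\<And>v. v \<in> D \<Longrightarrow> v \<in> admissible G \<and> \<omega> v \<noteq> \<infinity>" for D
  proof -
    have "sum w D + ?k D = (\<Sum>v\<in>D. w v + cost_of (\<omega> v))" by (simp add: sum.distrib)
    also have "\<dots> = (\<Sum>v\<in>D. card (closed_nbhd G v) * B)"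
      using that w by (intro sum.cong) auto
    finally show ?thesis by (simp add: sum_distrib_right)
  qed
  \<comment> \<open>Every e.d.s. of finite weight consists of candidates of positive value and so
    competes with \<open>I\<close>; its value is \<open>?n * B - ?k D\<close>.\<close>
  have compare: "?n * B - ?k D \<le> sum w I \<and> ?k D < B"
    if D: "eds G D" "sum \<omega> D \<noteq> \<infinity>" for D
  proof -
    have DV: "D \<subseteq> verts G" using D by (simp add: eds_def)
    have finD: "finite D" using DV fin finite_subset by blast
    have cand: "v \<in> admissible G \<and> \<omega> v \<noteq> \<infinity>" if "v \<in> D" for v
    proof
      show "v \<in> admissible G" using eds_admissible[OF D(1)] that by auto
      show "\<omega> v \<noteq> \<infinity>" using sum_infinity[OF finD that, of \<omega>] D(2) by auto
    qed
    have pos: "0 < w v" if "v \<in> D" for v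
    proof -
      have v: "v \<in> verts G" using that DV by auto
      have "v \<in> closed_nbhd G v" using v by (simp add: closed_nbhd_def)
      moreover have "finite (closed_nbhd G v)" using fin by (simp add: closed_nbhd_def)
      ultimately have "1 \<le> card (closed_nbhd G v)" by (metis One_nat_def Suc_leI card_gt_0_iff empty_iff)
      then have "B \<le> card (closed_nbhd G v) * B" by simp
      moreover have "cost_of (\<omega> v) < B" using kB[of "{v}"] v by simp
      ultimately show ?thesis using w[of v] cand[OF that] v by linarith
    qed
    have "packing (near G) D" using eds_near_eq[OF D(1)] by (auto simp: packing_def)
    moreover have "D \<subseteq> {v \<in> verts G. 0 < w v}" using DV pos by blast
    ultimately have "sum w D \<le> sum w I" using I by (simp add: max_packing_def)
    moreover have "sum w D + ?k D = ?n * B" using worth[OF DV cand] eds_sum_card[OF G D(1)] by simp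
    ultimately show ?thesis using kB[OF DV] by linarith
  qed
  have vI: "sum w I + ?k I = ?c I * B" using worth[OF IV(1) Icand] .
  \<comment> \<open>Leaving even one vertex undominated loses \<open>B\<close>, more than the whole
    weight of \<open>D\<^sub>0\<close>.\<close>
  have "?c I = ?n"
  proof (rule ccontr)
    assume "?c I \<noteq> ?n"
    then have "Suc (?c I) \<le> ?n" using packing_sum_card(1)[OF G IV] by linarith
    then have "Suc (?c I) * B \<le> ?n * B" by (rule mult_le_mono1)
    then have "B + ?c I * B \<le> ?n * B" by simp
    then show False using compare[OF D0, THEN conjunct1] compare[OF D0, THEN conjunct2] vI by linarith
  qed
  then have eds: "eds G I" using packing_sum_card(2)[OF G IV] by blast
  have finI: "finite I" using IV fin finite_subset by blast
  have sI: "sum \<omega> I = enat (?k I)" using sum_enat_cost_of[OF finI] Icand by blast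
  have "sum \<omega> I \<le> sum \<omega> D" if D: "eds G D" for D
  proof (cases "sum \<omega> D = \<infinity>")
    case False
    have finD: "finite D" using D fin finite_subset by (auto simp: eds_def)
    have "sum \<omega> D = enat (?k D)"
      using sum_enat_cost_of[OF finD] sum_infinity[OF finD] False by metis
    moreover have "?k I \<le> ?k D"
      using compare[OF D False, THEN conjunct1] vI[unfolded \<open>?c I = ?n\<close>] by linarith
    ultimately show ?thesis using sI by simp
  qed simp
  then show ?thesis using eds sI by (simp add: min_finite_eds_def)
qed

text \<open>If nothing of positive value is left, then \<open>x\<close> keeps its initial value 0 and \<open>d = 0\<close>.\<close>

definition elim_step :: "nat ugraph \<Rightarrow> nat \<Rightarrow> (nat \<Rightarrow> nat) \<Rightarrow> nat \<Rightarrow> nat \<Rightarrow> (nat \<Rightarrow> nat) \<Rightarrow> bool" where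
  "elim_step G n w x d w' \<longleftrightarrow> x < n \<and> d = w x \<and>
     (\<forall>y<n. w' y = (if near G x y then w y - d else w y)) \<and>
     (0 < d \<longrightarrow> (\<forall>y<n. \<forall>z<n. 0 < w y \<longrightarrow> 0 < w z \<longrightarrow> near G x y \<longrightarrow> near G x z \<longrightarrow> near G y z)) \<and>
     (d = 0 \<longrightarrow> (\<forall>y<n. w y = 0))"

section \<open>Forward elimination and backward selection\<close>

abbreviation elim_body :: prog where
  "elim_body \<equiv> PSeq flag_prog (PSeq choose_prog (PSeq delta_prog reduce_prog))"

lemma run_elim_body:
  assumes p: "prepared G \<omega> n s" and V: "verts G = {..<n}" and t: "s ''t'' 0 = t" "t < n"
    and ns: "\<forall>x<n. s ''ns'' (t * n + x) = 0" and ord: "s ''ord'' t = 0"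
    and free: "hole_free (\<lambda>u v. u \<noteq> v \<and> near G u v) {y. y < n \<and> 0 < s ''W'' y}"
  defines "s' \<equiv> run elim_body s"
  shows "prepared G \<omega> n s'"
    and "t' < n \<Longrightarrow> t' \<noteq> t \<Longrightarrow> x < n \<Longrightarrow> s ''ns'' (t' * n + x) = 0 \<Longrightarrow> s' ''ns'' (t' * n + x) = 0"
    and "t' \<noteq> t \<Longrightarrow> s' ''ord'' t' = s ''ord'' t'"
    and "t' \<noteq> t \<Longrightarrow> s' ''delta'' t' = s ''delta'' t'"
    and "elim_step G n (s ''W'') (s' ''ord'' t) (s' ''delta'' t) (s' ''W'')"
proof -
  define s1 where "s1 = run flag_prog s"
  define s2 where "s2 = run choose_prog s1"
  define s3 where "s3 = run delta_prog s2"
  have s': "s' = run reduce_prog s3" by (simp add: s'_def s1_def s2_def s3_def)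
  have f1: "y \<notin> {''ns'', ''u'', ''v'', ''w''} \<Longrightarrow> s1 y = s y" for y
    unfolding s1_def by (rule run_frame) (simp add: writes_progs)
  have f2: "y \<notin> {''ord'', ''u''} \<Longrightarrow> s2 y = s1 y" for y
    unfolding s2_def by (rule run_frame) (simp add: writes_progs)
  have f3: "y \<notin> {''delta''} \<Longrightarrow> s3 y = s2 y" for y
    unfolding s3_def by (rule run_frame) (simp add: writes_progs)
  have f4: "y \<notin> {''W'', ''v''} \<Longrightarrow> s' y = s3 y" for y
    unfolding s' by (rule run_frame) (simp add: writes_progs)
  have p1: "prepared G \<omega> n s1" by (rule prepared_cong[OF p]) (auto simp: f1)
  have p2: "prepared G \<omega> n s2" by (rule prepared_cong[OF p1]) (auto simp: f2)
  have p3: "prepared G \<omega> n s3" by (rule prepared_cong[OF p2]) (auto simp: f3)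
  show "prepared G \<omega> n s'" by (rule prepared_cong[OF p3]) (auto simp: f4)
  have ns1: "0 < s1 ''ns'' (t' * n + x) \<longleftrightarrow> t' = t \<and>
      (\<exists>v<n. \<exists>w<n. (0 < s ''W'' v \<and> 0 < s ''W'' w) \<and> (near G x v \<and> near G x w) \<and> \<not> near G v w)"
    if "t' < n" "x < n" "s ''ns'' (t' * n + x) = 0" for t' x
    unfolding s1_def by (rule run_flag[OF p t that])
  show "s' ''ns'' (t' * n + x) = 0" if "t' < n" "t' \<noteq> t" "x < n" "s ''ns'' (t' * n + x) = 0" for t' x
    using ns1[OF that(1,3,4)] that(2) by (simp add: f2 f3 f4)
  have ord1: "s1 ''ord'' t < n" using ord t by (simp add: f1)
  have t1: "s1 ''t'' 0 = t" using t by (simp add: f1)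
  note ch = run_choose[OF p1 t1 t(2) ord1, folded s2_def]
  show "s' ''ord'' t' = s ''ord'' t'" if "t' \<noteq> t" for t'
    using ch(3)[OF that] by (simp add: f1 f3 f4)
  have d3: "s3 ''delta'' = (s2 ''delta'')(t := s2 ''W'' (s2 ''ord'' t))"
    using t1 by (simp add: s3_def delta_prog_def f2)
  show "s' ''delta'' t' = s ''delta'' t'" if "t' \<noteq> t" for t'
    using that by (simp add: f1 f2 f4 d3)
  define x where "x = s' ''ord'' t"
  have x: "x = s2 ''ord'' t" "x = s3 ''ord'' t" "x < n"
    using ch(2) by (simp_all add: x_def f3 f4)
  have d: "s' ''delta'' t = s ''W'' x"
    using x by (simp add: f1 f2 f4 d3)
  have W3: "s3 ''W'' = s ''W''" by (simp add: f1 f2 f3)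
  have t3: "s3 ''t'' 0 = t" using t1 by (simp add: f2 f3)
  have W': "s' ''W'' y = (if near G x y then s ''W'' y - s' ''delta'' t else s ''W'' y)" if "y < n" for y
    using run_reduce[OF p3 t3 _ that] x W3 by (simp add: s' [symmetric] f4)
  let ?X = "{y. y < n \<and> 0 < s ''W'' y}"
  have simp_iff: "s1 ''ns'' (t * n + y) = 0 \<longleftrightarrow>
      (\<forall>v<n. \<forall>w<n. 0 < s ''W'' v \<longrightarrow> 0 < s ''W'' w \<longrightarrow> near G y v \<longrightarrow> near G y w \<longrightarrow> near G v w)" if "y < n" for y
    using ns1[OF t(2) that ns[rule_format, OF that]] by auto
  have exists: "\<exists>y. y < n \<and> 0 < s1 ''W'' y \<and> s1 ''ns'' (t * n + y) = 0" if ne: "?X \<noteq> {}"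
  proof -
    have "finite ?X" by simp
    moreover have "symp (\<lambda>u v. u \<noteq> v \<and> near G u v)" "irreflp (\<lambda>u v. u \<noteq> v \<and> near G u v)"
      using near_sym[THEN iffD1] by (auto simp: symp_def irreflp_def)
    ultimately obtain b where b: "b \<in> ?X" "simplicial (\<lambda>u v. u \<noteq> v \<and> near G u v) ?X b"
      using hole_free_simplicial[OF _ free _ _ ne] by blast
    \<comment> \<open>The flags use the reflexive relation \<open>near\<close>, while
      \<open>simplicial\<close> is applied to its irreflexive part; the cases with coinciding
      vertices follow from reflexivity and symmetry.\<close>
    have "near G v w" if "v < n" "w < n" "0 < s ''W'' v" "0 < s ''W'' w" "near G b v" "near G b w" for v w
    proof -
      consider "v = w" | "b = v" | "b = w" | "v \<noteq> w" "b \<noteq> v" "b \<noteq> w" by blast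
      then show ?thesis
      proof cases
        case 1
        then show ?thesis using near_refl[of v G] that(1) V by simp
      next
        case 3
        then show ?thesis using that near_sym[of G b v] by simp
      next
        case 4
        then show ?thesis using b(2) that unfolding simplicial_def by simp
      qed (use that in simp)
    qed
    then show ?thesis using b simp_iff by (auto simp: f1)
  qed
  show "elim_step G n (s ''W'') (s' ''ord'' t) (s' ''delta'' t) (s' ''W'')"
    unfolding x_def[symmetric] elim_step_def
  proof (intro conjI impI)
    show "\<forall>y<n. s' ''W'' y = (if near G x y then s ''W'' y - s' ''delta'' t else s ''W'' y)"
      using W' by blast
    have C: "s1 ''ns'' (t * n + x) = 0 \<and> 0 < s ''W'' x" if "?X \<noteq> {}"
      using ch(1)[OF exists[OF that]] x by (simp add: f1)
    show "\<forall>y<n. \<forall>z<n. 0 < s ''W'' y \<longrightarrow> 0 < s ''W'' z \<longrightarrow> near G x y \<longrightarrow> near G x z \<longrightarrow> near G y z"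
      if "0 < s' ''delta'' t"
    proof -
      have "?X \<noteq> {}" using that d x by auto
      then show ?thesis using C simp_iff[OF x(3)] by blast
    qed
    show "\<forall>y<n. s ''W'' y = 0" if "s' ''delta'' t = 0"
      using C that d by force
  qed (use x d in auto)
qed

text \<open>In each round the chosen vertex loses its entire value, so the number of positive values
  drops until it is 0, and \<open>n\<close> rounds suffice. The set of positive values only shrinks,
  which preserves hole-freeness. The store keeps just the current values; \<open>w\<close> is their
  history, needed to undo the rounds.\<close>

lemma run_elim:
  assumes p: "prepared G \<omega> n s" and V: "verts G = {..<n}"
    and ns: "\<And>i. s ''ns'' i = 0" and ord: "\<And>i. s ''ord'' i = 0"
    and free: "hole_free (\<lambda>u v. u \<noteq> v \<and> near G u v) {y. y < n \<and> 0 < s ''W'' y}"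
  obtains w where "w 0 = s ''W''" "\<And>y. y < n \<Longrightarrow> w n y = 0"
    "\<And>t. t < n \<Longrightarrow> elim_step G n (w t) (run elim_prog s ''ord'' t) (run elim_prog s ''delta'' t) (w (Suc t))"
proof -
  define I where "I t s' \<longleftrightarrow> prepared G \<omega> n s' \<and> (\<forall>t'. t \<le> t' \<longrightarrow> t' < n \<longrightarrow> (\<forall>x<n. s' ''ns'' (t' * n + x) = 0)) \<and>
      (\<forall>t'\<ge>t. s' ''ord'' t' = 0) \<and> (\<exists>w. w 0 = s ''W'' \<and> w t = s' ''W'' \<and>
        (\<forall>t'<t. elim_step G n (w t') (s' ''ord'' t') (s' ''delta'' t') (w (Suc t'))) \<and>
        {y. y < n \<and> 0 < w t y} \<subseteq> {y. y < n \<and> 0 < s ''W'' y} \<and> card {y. y < n \<and> 0 < w t y} \<le> n - t)" for t s'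
  have n: "s ''n'' 0 = n" using preparedD(1)[OF p] .
  obtain s' where s': "I (s ''n'' 0) s'" "run (PFor ''t'' elim_body) s = set0 s' ''t'' (s ''n'' 0)"
  proof (rule run_For_induct[of I s elim_body "''t''"])
    have "card {y. y < n \<and> 0 < s ''W'' y} \<le> n"
      using card_mono[of "{..<n}" "{y. y < n \<and> 0 < s ''W'' y}"] by auto
    then show "I 0 s" using p ns ord by (auto simp: I_def intro!: exI[of _ "\<lambda>_. s ''W''"])
    fix t s'
    assume "t < s ''n'' 0" and I: "I t s'"
    then have t: "t < n" using n by simp
    define s0 where "s0 = set0 s' ''t'' t"
    have s0: "s0 ''t'' 0 = t" "s0 ''ns'' = s' ''ns''" "s0 ''ord'' = s' ''ord''" "s0 ''W'' = s' ''W''" "s0 ''delta'' = s' ''delta''"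
      by (simp_all add: s0_def)
    let ?r = "run elim_body s0"
    from I obtain w where w: "w 0 = s ''W''" "w t = s' ''W''"
        "\<forall>t'<t. elim_step G n (w t') (s' ''ord'' t') (s' ''delta'' t') (w (Suc t'))"
        "{y. y < n \<and> 0 < w t y} \<subseteq> {y. y < n \<and> 0 < s ''W'' y}" "card {y. y < n \<and> 0 < w t y} \<le> n - t"
      unfolding I_def by blast
    have "prepared G \<omega> n s'" using I by (simp add: I_def)
    then have p': "prepared G \<omega> n s0" by (rule prepared_cong) (auto simp: s0_def)
    have ns': "s0 ''ns'' (t' * n + x) = 0" if "t \<le> t'" "t' < n" "x < n" for t' x
      using I that by (simp add: I_def s0)
    have ns't: "\<forall>x<n. s0 ''ns'' (t * n + x) = 0"
      using ns'[OF order_refl t] by blast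
    have ord': "s0 ''ord'' t' = 0" if "t \<le> t'" for t' using I that by (simp add: I_def s0)
    have free': "hole_free (\<lambda>u v. u \<noteq> v \<and> near G u v) {y. y < n \<and> 0 < s0 ''W'' y}"
      using hole_free_mono[OF free] w(2,4) by (simp add: s0)
    note b = run_elim_body[OF p' V s0(1) t ns't ord'[OF order_refl] free']
    have step: "elim_step G n (w t) (?r ''ord'' t) (?r ''delta'' t) (?r ''W'')"
      using b(5) w(2) by (simp only: s0)
    define w' where "w' = w(Suc t := ?r ''W'')"
    have w't: "w' t' = w t'" if "t' \<le> t" for t' using that by (simp add: w'_def)
    have sub: "{y. y < n \<and> 0 < w' (Suc t) y} \<subseteq> {y. y < n \<and> 0 < w t y}"
      using step by (auto simp: w'_def elim_step_def split: if_splits)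
    have "card {y. y < n \<and> 0 < w' (Suc t) y} \<le> n - Suc t"
    proof (cases "?r ''delta'' t = 0")
      case True
      then have "{y. y < n \<and> 0 < w' (Suc t) y} = {}" using step sub by (auto simp: elim_step_def)
      then show ?thesis by (simp only: card.empty)
    next
      case False
      let ?x = "?r ''ord'' t"
      have "?x < n" "0 < w t ?x" using step False by (auto simp: elim_step_def)
      moreover have "w' (Suc t) ?x = 0"
        using step near_refl[of ?x G] V by (auto simp: w'_def elim_step_def)
      ultimately have "?x \<in> {y. y < n \<and> 0 < w t y}" "?x \<notin> {y. y < n \<and> 0 < w' (Suc t) y}"
        by simp_all
      then have "{y. y < n \<and> 0 < w' (Suc t) y} \<subset> {y. y < n \<and> 0 < w t y}"
        using sub by blast
      then have "card {y. y < n \<and> 0 < w' (Suc t) y} < card {y. y < n \<and> 0 < w t y}"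
        by (intro psubset_card_mono) auto
      then show ?thesis using w(5) by linarith
    qed
    moreover have "elim_step G n (w' t') (?r ''ord'' t') (?r ''delta'' t') (w' (Suc t'))" if "t' < Suc t" for t'
    proof (cases "t' = t")
      case True
      then show ?thesis using step by (simp add: w'_def)
    next
      case False
      then have "t' < t" using that by simp
      then show ?thesis using w(3) b(3)[OF False] b(4)[OF False] by (simp add: w't s0)
    qed
    moreover have "{y. y < n \<and> 0 < w' (Suc t) y} \<subseteq> {y. y < n \<and> 0 < s ''W'' y}" using sub w(4) by blast
    moreover have "w' 0 = s ''W''" "w' (Suc t) = ?r ''W''" using w(1) by (simp_all add: w'_def)
    ultimately have "\<exists>w. w 0 = s ''W'' \<and> w (Suc t) = ?r ''W'' \<and>
        (\<forall>t'<Suc t. elim_step G n (w t') (?r ''ord'' t') (?r ''delta'' t') (w (Suc t'))) \<and>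
        {y. y < n \<and> 0 < w (Suc t) y} \<subseteq> {y. y < n \<and> 0 < s ''W'' y} \<and> card {y. y < n \<and> 0 < w (Suc t) y} \<le> n - Suc t"
      by blast
    moreover have "?r ''ns'' (t' * n + x) = 0" if "Suc t \<le> t'" "t' < n" "x < n" for t' x
      using b(2)[of t' x] ns'[of t' x] that by simp
    moreover have "?r ''ord'' t' = 0" if "Suc t \<le> t'" for t'
      using b(3)[of t'] ord'[of t'] that by simp
    ultimately show "I (Suc t) (run elim_body (set0 s' ''t'' t))" using b(1) unfolding I_def s0_def[symmetric] by blast
  qed
  have e: "run elim_prog s y = s' y" if "y \<noteq> ''t''" for y
    using s'(2) that by (simp add: elim_prog_def)
  obtain w where w: "w 0 = s ''W''"
      "\<forall>t'<n. elim_step G n (w t') (s' ''ord'' t') (s' ''delta'' t') (w (Suc t'))" "card {y. y < n \<and> 0 < w n y} \<le> 0"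
    using s'(1) unfolding I_def n by auto
  have "w n y = 0" if "y < n" for y
    using w(3) that by auto
  then show thesis using that[of w] w(1,2) by (simp add: e)
qed

lemma max_packing_cong:
  assumes "\<And>v. v \<in> V \<Longrightarrow> w v = w' v" "max_packing q w V I"
  shows "max_packing q w' V I"
proof -
  have "{v \<in> V. 0 < w v} = {v \<in> V. 0 < w' v}" using assms(1) by auto
  moreover have "sum w J = sum w' J" if "J \<subseteq> {v \<in> V. 0 < w' v}" for J
    using that assms(1) by (intro sum.cong) auto
  moreover have "I \<subseteq> {v \<in> V. 0 < w v}" using assms(2) by (simp add: max_packing_def)
  ultimately show ?thesis using assms(2) unfolding max_packing_def by metis
qed

text \<open>Undoing the rounds, the invariant is that the current set is a maximum packing for
  \<open>w (n - t)\<close>. It starts with the empty set for the zero weight, and each round is one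
  application of \<open>max_packing_local_ratio\<close>.\<close>

lemma run_pick:
  assumes p: "prepared G \<omega> n s" and V: "verts G = {..<n}"
    and cf: "\<And>i. s ''cf'' i = 0" and D: "\<And>i. s ''D'' i = 0"
    and wn: "\<And>y. y < n \<Longrightarrow> w n y = 0"
    and step: "\<And>t. t < n \<Longrightarrow> elim_step G n (w t) (s ''ord'' t) (s ''delta'' t) (w (Suc t))"
  shows "max_packing (near G) (w 0) {..<n} {v. v < n \<and> run pick_prog s ''D'' v = 1}"
proof -
  let ?b = "And (Pos (Cell ''delta'' Rev)) (Not (Pos (Cell ''cf'' Rev)))"
  let ?p = "PSeq conflict_prog (PIf ?b (PAsg ''D'' (Cell ''ord'' Rev) (Const 1)) PSkip)"
  define S where "S s' = {v. v < n \<and> s' ''D'' v = 1}" for s' :: store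
  define I where "I t s' \<longleftrightarrow> (\<forall>y. y \<notin> {''cf'', ''D'', ''t'', ''v''} \<longrightarrow> s' y = s y) \<and> (\<forall>j<n - t. s' ''cf'' j = 0) \<and>
      max_packing (near G) (w (n - t)) {..<n} (S s')" for t s'
  have n: "s ''n'' 0 = n" using preparedD(1)[OF p] .
  obtain s' where s': "I (s ''n'' 0) s'" "run (PFor ''t'' ?p) s = set0 s' ''t'' (s ''n'' 0)"
  proof (rule run_For_induct[of I s ?p "''t''"])
    have "S s = {}" using D by (simp add: S_def)
    moreover have "max_packing (near G) (w n) {..<n} {}"
      unfolding max_packing_def
    proof (intro conjI allI impI)
      fix J assume "J \<subseteq> {v \<in> {..<n}. 0 < w n v}"
      then have "J = {}" using wn by fastforce
      then show "sum (w n) J \<le> sum (w n) {}" by simp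
    qed (simp_all add: packing_def)
    ultimately show "I 0 s" using cf by (simp add: I_def)
    fix t s'
    assume "t < s ''n'' 0" and I: "I t s'"
    then have t: "t < n" using n by simp
    define j where "j = n - Suc t"
    have j: "j < n" "Suc j = n - t" using t by (auto simp: j_def)
    define s0 where "s0 = set0 s' ''t'' t"
    have s0: "s0 ''t'' 0 = t" "s0 ''cf'' = s' ''cf''" "s0 ''D'' = s' ''D''"
      by (simp_all add: s0_def)
    have f: "s0 y = s y" if "y \<notin> {''cf'', ''D'', ''t'', ''v''}" for y
      using I that by (auto simp: I_def s0_def)
    have p': "prepared G \<omega> n s0" by (rule prepared_cong[OF p], rule f) auto
    define r where "r = run conflict_prog s0"
    have fr: "r y = s0 y" if "y \<notin> {''cf'', ''v''}" for y
      unfolding r_def by (rule run_frame) (use that in \<open>simp add: writes_progs\<close>)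
    define x where "x = s ''ord'' j"
    have stepj: "elim_step G n (w j) x (s ''delta'' j) (w (n - t))"
      using step[OF j(1)] j(2) by (simp add: x_def)
    have xn: "x < n" using stepj by (simp add: elim_step_def)
    have cf': "s' ''cf'' i = 0" if "i < n - t" for i using I that by (simp add: I_def)
    have ox: "s0 ''ord'' (n - Suc t) = x" by (simp add: f x_def j_def)
    have conf: "0 < r ''cf'' j \<longleftrightarrow> (\<exists>v<n. near G x v \<and> s0 ''D'' v = 1)" "\<And>i. i < n - Suc t \<Longrightarrow> r ''cf'' i = 0"
      using run_conflict[OF p' s0(1)] ox xn cf' j t unfolding r_def by (auto simp: j_def s0)
    have rev: "aval Rev r = j" using n by (simp add: fr f s0 j_def)
    have bv: "bval ?b r \<longleftrightarrow> 0 < s ''delta'' j \<and> \<not> (\<exists>v\<in>S s'. near G x v)"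
    proof -
      have "bval ?b r \<longleftrightarrow> 0 < r ''delta'' (aval Rev r) \<and> \<not> 0 < r ''cf'' (aval Rev r)" by (simp del: aval.simps(4))
      then show ?thesis unfolding rev conf(1) by (auto simp: fr f s0 S_def)
    qed
    have Ipack: "max_packing (near G) (w (n - t)) {..<n} (S s')" using I by (simp add: I_def)
    define r' where "r' = run (PIf ?b (PAsg ''D'' (Cell ''ord'' Rev) (Const 1)) PSkip) r"
    have r'_D: "r' ''D'' = (if bval ?b r then (s' ''D'')(x := 1) else s' ''D'')"
    proof -
      have e: "aval (Cell ''ord'' Rev) r = x" unfolding aval.simps(2) rev by (simp add: fr f x_def)
      show ?thesis unfolding r'_def run.simps e by (simp add: fr s0)
    qed
    have r'_o: "r' y = r y" if "y \<noteq> ''D''" for y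
      unfolding r'_def using that by simp
    have S': "S r' = (if bval ?b r then insert x (S s') else S s')"
      using xn by (auto simp: S_def r'_D)
    have "max_packing (near G) (w j) {..<n} (S r')"
    \<comment> \<open>A round with \<open>delta\<close> 0 found no positive value and left the
      weights unchanged, so there is nothing to undo.\<close>
    proof (cases "s ''delta'' j = 0")
      case True
      then have "w j y = w (n - t) y" if "y < n" for y
        using stepj that by (simp add: elim_step_def)
      then have "max_packing (near G) (w j) {..<n} (S s')"
        by (intro max_packing_cong[OF _ Ipack]) auto
      then show ?thesis unfolding S' bv using True by simp
    next
      case False
      have "max_packing (near G) (w j) {..<n} (if \<exists>v\<in>S s'. near G x v then S s' else insert x (S s'))"
      proof (rule max_packing_local_ratio[OF _ _ _ _ _ _ _ Ipack])
        show "near G u v \<Longrightarrow> near G v u" for u v using near_sym by metis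
        show "near G x x" using near_refl[of x G] xn V by simp
        show "0 < w j x" using False stepj by (simp add: elim_step_def)
        show "near G y z" if "y \<in> {..<n}" "z \<in> {..<n}" "0 < w j y" "0 < w j z" "near G x y" "near G x z" for y z
          using stepj False that by (auto simp: elim_step_def)
        show "w (n - t) y = (if near G x y then w j y - w j x else w j y)" if "y \<in> {..<n}" for y
          using stepj that by (simp add: elim_step_def)
      qed (use xn in auto)
      moreover have "S r' = (if \<exists>v\<in>S s'. near G x v then S s' else insert x (S s'))"
        unfolding S' bv using False by auto
      ultimately show ?thesis by simp
    qed
    moreover have "run ?p s0 = r'" unfolding run.simps(3) r_def r'_def ..
    ultimately show "I (Suc t) (run ?p (set0 s' ''t'' t))"
      using conf(2) unfolding s0_def[symmetric] by (auto simp: I_def r'_o fr f j_def)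
  qed
  have "run pick_prog s ''D'' = s' ''D''" using s'(2) by (simp add: pick_prog_def)
  then show ?thesis using s'(1) n by (simp add: I_def S_def)
qed

text \<open>
  The final check makes the answer correct on inputs without an e.d.s. of finite weight, where
  nothing is known about the preceding phases.
\<close>

lemma run_check:
  assumes p: "prepared G \<omega> n s" and G: "simple_graph G" and V: "verts G = {..<n}"
    and z: "\<And>i. s ''dom'' i = 0" "s ''fail'' 0 = 0" "s ''found'' 0 = 0"
  defines "D \<equiv> {v. v < n \<and> s ''D'' v = 1}"
  defines "s' \<equiv> run (PSeq dom_prog (PSeq fail_prog found_prog)) s"
  shows "s' ''D'' = s ''D''" and "s' ''found'' 0 = (if eds G D \<and> sum \<omega> D \<noteq> \<infinity> then 1 else 0)"
proof -
  define s1 where "s1 = run dom_prog s"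
  define s2 where "s2 = run fail_prog s1"
  have s': "s' = run found_prog s2" by (simp add: s'_def s1_def s2_def)
  have f1: "y \<notin> {''dom'', ''u'', ''v''} \<Longrightarrow> s1 y = s y" for y
    unfolding s1_def by (rule run_frame) (simp add: writes_progs)
  have f2: "y \<notin> {''fail'', ''v''} \<Longrightarrow> s2 y = s1 y" for y
    unfolding s2_def by (rule run_frame) (simp add: writes_progs)
  have f3: "y \<notin> {''found''} \<Longrightarrow> s' y = s2 y" for y
    unfolding s' by (rule run_frame) (simp add: writes_progs)
  show "s' ''D'' = s ''D''" by (simp add: f1 f2 f3)
  have p1: "prepared G \<omega> n s1" by (rule prepared_cong[OF p], rule f1) auto
  have sub: "closed_nbhd G v \<subseteq> {..<n}" for v using V by (auto simp: closed_nbhd_def)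
  have finD: "finite D" by (simp add: D_def)
  have dom: "s1 ''dom'' v = card (D \<inter> closed_nbhd G v)" if "v < n" for v
    unfolding s1_def D_def by (rule run_dom[OF p z(1) that sub])
  have fail0: "s1 ''fail'' 0 = 0" using z by (simp add: f1)
  have "0 < s2 ''fail'' 0 \<longleftrightarrow> (\<exists>v<n. s1 ''dom'' v \<noteq> 1 \<or> s1 ''D'' v = 1 \<and> \<omega> v = \<infinity>)"
    unfolding s2_def by (rule run_fail[OF p1 fail0])
  also have "\<dots> \<longleftrightarrow> \<not> ((\<forall>v<n. card (D \<inter> closed_nbhd G v) = 1) \<and> (\<forall>v\<in>D. \<omega> v \<noteq> \<infinity>))"
    using dom by (auto simp: f1 D_def)
  also have "(\<forall>v<n. card (D \<inter> closed_nbhd G v) = 1) \<longleftrightarrow> eds G D"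
    using V by (auto simp: eds_def D_def)
  also have "(\<forall>v\<in>D. \<omega> v \<noteq> \<infinity>) \<longleftrightarrow> sum \<omega> D \<noteq> \<infinity>"
    using sum_infinity[OF finD] sum_enat_cost_of[OF finD, of \<omega>] by force
  finally have fail: "0 < s2 ''fail'' 0 \<longleftrightarrow> \<not> (eds G D \<and> sum \<omega> D \<noteq> \<infinity>)" .
  have "s2 ''found'' 0 = 0" using z by (simp add: f1 f2)
  then show "s' ''found'' 0 = (if eds G D \<and> sum \<omega> D \<noteq> \<infinity> then 1 else 0)"
    unfolding s' found_prog_def using fail by simp
qed

section \<open>Assembly of the program and its running time\<close>

definition prep_prog :: prog where
  "prep_prog = PSeq row_prog (PSeq diag_prog (PSeq near_prog (PSeq ok_prog (PSeq bad_prog (PSeq big_prog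
     (PSeq value_prog1 value_prog2))))))"

lemma run_prep:
  fixes \<omega> :: "nat \<Rightarrow> enat"
  assumes G: "simple_graph G" and V: "verts G = {..<n}"
  defines "s \<equiv> run prep_prog (wed_input (G, \<omega>))"
  defines "B \<equiv> Suc (\<Sum>v<n. weight_code (\<omega> v))"
  shows "prepared G \<omega> n s"
    and "v < n \<Longrightarrow> s ''W'' v = (if v \<in> admissible G \<and> \<omega> v \<noteq> \<infinity> then card (closed_nbhd G v) * B - cost_of (\<omega> v) else 0)"
    and "y \<in> {''ns'', ''ord'', ''cf'', ''D'', ''dom'', ''fail'', ''found''} \<Longrightarrow> s y i = 0"
proof -
  let ?s = "wed_input (G, \<omega>)"
  have card: "card (verts G) = n" using V by simp
  define s1 where "s1 = run row_prog ?s"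
  define s2 where "s2 = run diag_prog s1"
  define s3 where "s3 = run near_prog s2"
  define s4 where "s4 = run ok_prog s3"
  define s5 where "s5 = run bad_prog s4"
  define s6 where "s6 = run big_prog s5"
  have s: "s = run value_prog2 (run value_prog1 s6)"
    by (simp add: s_def prep_prog_def s1_def s2_def s3_def s4_def s5_def s6_def)
  have z: "?s y i = 0" if "y \<notin> {''n'', ''adj'', ''weight''}" for y i
    using that by (simp add: wed_input_def Let_def)
  have in_n: "?s ''n'' 0 = n" by (simp add: wed_input_def Let_def card)
  have in_adj: "0 < ?s ''adj'' (u * n + v) \<longleftrightarrow> {u, v} \<in> edges G" if "u < n" "v < n" for u v
  proof -
    have "u * n + v < n * n"
    proof -
      have "u * n + v < Suc u * n" using that by simp
      also have "\<dots> \<le> n * n" using that by (intro mult_le_mono1) simp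
      finally show ?thesis .
    qed
    moreover have "(u * n + v) div n = u" "(u * n + v) mod n = v" using that by simp_all
    ultimately show ?thesis by (simp add: wed_input_def Let_def card)
  qed
  have in_weight: "?s ''weight'' v = weight_code (\<omega> v)" if "v < n" for v
    using that by (simp add: wed_input_def Let_def card)
  have f1: "y \<notin> {''row'', ''u'', ''v''} \<Longrightarrow> s1 y = ?s y" for y
    unfolding s1_def by (rule run_frame) (simp add: writes_progs)
  have f2: "y \<notin> {''adj'', ''u''} \<Longrightarrow> s2 y = s1 y" for y
    unfolding s2_def by (rule run_frame) (simp add: writes_progs)
  have f3: "y \<notin> {''near'', ''u'', ''v'', ''w''} \<Longrightarrow> s3 y = s2 y" for y
    unfolding s3_def by (rule run_frame) (simp add: writes_progs)
  have f4: "y \<notin> {''ok'', ''u'', ''v'', ''w''} \<Longrightarrow> s4 y = s3 y" for y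
    unfolding s4_def by (rule run_frame) (simp add: writes_progs)
  have f5: "y \<notin> {''bad'', ''u'', ''v''} \<Longrightarrow> s5 y = s4 y" for y
    unfolding s5_def by (rule run_frame) (simp add: writes_progs)
  have f6: "y \<notin> {''big'', ''v''} \<Longrightarrow> s6 y = s5 y" for y
    unfolding s6_def by (rule run_frame) (simp add: writes_progs)
  have f7: "y \<notin> {''W'', ''u'', ''v''} \<Longrightarrow> s y = s6 y" for y
    unfolding s using run_frame[of y value_prog2] run_frame[of y value_prog1] by (simp add: writes_progs)
  have row1: "s1 ''row'' u = u * n" if "u < n" for u
    unfolding s1_def by (rule run_row) (use in_n that in \<open>simp_all add: z\<close>)
  have n1: "s1 ''n'' 0 = n" using in_n by (simp add: f1)
  have adj2: "0 < s2 ''adj'' (u * n + v) \<longleftrightarrow> v \<in> closed_nbhd G u" if "u < n" "v < n" for u v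
    unfolding s2_def using run_diag[OF n1 row1 that] in_adj[OF that] that V
    by (auto simp: f1 closed_nbhd_def insert_commute)
  have row2: "s2 ''row'' u = u * n" if "u < n" for u using row1[OF that] by (simp add: f2)
  have n2: "s2 ''n'' 0 = n" using n1 by (simp add: f2)
  have near2: "s2 ''near'' i = 0" for i by (simp add: f1 f2 z)
  have near3: "0 < s3 ''near'' (u * n + v) \<longleftrightarrow> near G u v" if "u < n" "v < n" for u v
  proof -
    have "0 < s3 ''near'' (u * n + v) \<longleftrightarrow> (\<exists>w<n. 0 < s2 ''adj'' (u * n + w) \<and> 0 < s2 ''adj'' (v * n + w))"
      unfolding s3_def by (rule run_near[OF n2 row2 near2 that])
    also have "\<dots> \<longleftrightarrow> (\<exists>w<n. w \<in> closed_nbhd G u \<and> w \<in> closed_nbhd G v)"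
      using adj2 that by auto
    also have "\<dots> \<longleftrightarrow> near G u v" using V by (auto simp: near_def closed_nbhd_def)
    finally show ?thesis .
  qed
  have p3: "prepared G \<omega> n s3"
    using n2 row2 adj2 near3 in_weight by (simp add: prepared_def f1 f2 f3)
  have ok4: "0 < s4 ''ok'' (v * n + u) \<longleftrightarrow> (\<exists>w<n. w \<in> closed_nbhd G u \<and> (w = v \<or> \<not> near G w v))"
    if "u < n" "v < n" for u v
    unfolding s4_def by (rule run_ok[OF p3 _ that]) (simp add: f1 f2 f3 z)
  have p4: "prepared G \<omega> n s4" by (rule prepared_cong[OF p3], rule f4) auto
  have bad5: "0 < s5 ''bad'' v \<longleftrightarrow> v \<notin> admissible G" if "v < n" for v
  proof -
    have "0 < s5 ''bad'' v \<longleftrightarrow> (\<exists>u<n. s4 ''ok'' (v * n + u) = 0)"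
      unfolding s5_def by (rule run_bad[OF p4 _ that]) (simp add: f1 f2 f3 f4 z)
    also have "\<dots> \<longleftrightarrow> (\<exists>u<n. \<not> (\<exists>w<n. w \<in> closed_nbhd G u \<and> (w = v \<or> \<not> near G w v)))"
      using ok4 that by (metis neq0_conv)
    also have "\<dots> \<longleftrightarrow> v \<notin> admissible G"
      using that V by (auto simp: admissible_def closed_nbhd_def)
    finally show ?thesis .
  qed
  have p5: "prepared G \<omega> n s5" by (rule prepared_cong[OF p4], rule f5) auto
  have n5: "s5 ''n'' 0 = n" using preparedD(1)[OF p5] .
  have "s6 ''big'' 0 = (\<Sum>v<n. s5 ''weight'' v)"
    unfolding s6_def by (rule run_big) (use n5 in \<open>simp_all add: f1 f2 f3 f4 f5 z\<close>)
  then have B: "Suc (s6 ''big'' 0) = B"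
    using preparedD(5)[OF p5] by (simp add: B_def)
  have p6: "prepared G \<omega> n s6" by (rule prepared_cong[OF p5], rule f6) auto
  show "prepared G \<omega> n s" by (rule prepared_cong[OF p6], rule f7) auto
  show "s y i = 0" if "y \<in> {''ns'', ''ord'', ''cf'', ''D'', ''dom'', ''fail'', ''found''}" for y i
    using that by (auto simp: f1 f2 f3 f4 f5 f6 f7 z)
  show "s ''W'' v = (if v \<in> admissible G \<and> \<omega> v \<noteq> \<infinity> then card (closed_nbhd G v) * B - cost_of (\<omega> v) else 0)" if "v < n"
  proof -
    have "s ''W'' v = (if 0 < s6 ''weight'' v \<and> s6 ''bad'' v = 0
        then card (closed_nbhd G v) * Suc (s6 ''big'' 0) - (s6 ''weight'' v - 1) else 0)"
      unfolding s
    proof (rule run_value[OF p6 _ that])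
      show "s6 ''W'' i = 0" for i by (simp add: f1 f2 f3 f4 f5 f6 z)
      show "s6 ''weight'' u \<le> s6 ''big'' 0" if "u < n" for u
      proof -
        have "weight_code (\<omega> u) \<le> (\<Sum>v<n. weight_code (\<omega> v))"
          using that by (intro member_le_sum) auto
        then show ?thesis using B preparedD(5)[OF p6 that] by (simp add: B_def)
      qed
      show "closed_nbhd G v \<subseteq> {..<n}" "v \<in> closed_nbhd G v" using V that by (auto simp: closed_nbhd_def)
    qed
    moreover have "0 < s6 ''weight'' v \<longleftrightarrow> \<omega> v \<noteq> \<infinity>"
      unfolding preparedD(5)[OF p6 that] by (auto simp: weight_code_def split: enat.splits)
    moreover have "s6 ''bad'' v = 0 \<longleftrightarrow> v \<in> admissible G"
      using bad5[OF that] by (auto simp: f6)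
    moreover have "s6 ''weight'' v - 1 = cost_of (\<omega> v)"
      unfolding preparedD(5)[OF p6 that] by (simp add: cost_of_def)
    ultimately show ?thesis unfolding B by auto
  qed
qed

lemma wed_prog_correct:
  assumes G: "simple_graph G" and V: "verts G = {..<n}" and free: "induced_free S123 G" "chordal G"
  shows "wed_answer (G, \<omega>) (run wed_prog (wed_input (G, \<omega>)))"
proof -
  define s1 where "s1 = run prep_prog (wed_input (G, \<omega>))"
  define s2 where "s2 = run elim_prog s1"
  define s3 where "s3 = run pick_prog s2"
  define s4 where "s4 = run (PSeq dom_prog (PSeq fail_prog found_prog)) s3"
  have run: "run wed_prog (wed_input (G, \<omega>)) = s4"
    by (simp add: wed_prog_def prep_prog_def s1_def s2_def s3_def s4_def)
  note prep = run_prep[OF G V, where \<omega> = \<omega>, folded s1_def]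
  have f2: "y \<notin> {''ns'', ''ord'', ''delta'', ''W'', ''t'', ''u'', ''v'', ''w''} \<Longrightarrow> s2 y = s1 y" for y
    unfolding s2_def by (rule run_frame) (simp add: writes_progs)
  have f3: "y \<notin> {''cf'', ''D'', ''t'', ''v''} \<Longrightarrow> s3 y = s2 y" for y
    unfolding s3_def by (rule run_frame) (simp add: writes_progs)
  have p2: "prepared G \<omega> n s2" by (rule prepared_cong[OF prep(1)], rule f2) auto
  have p3: "prepared G \<omega> n s3" by (rule prepared_cong[OF p2], rule f3) auto
  define D where "D = {v. v < n \<and> s3 ''D'' v = 1}"
  have chk: "s4 ''D'' = s3 ''D''" "s4 ''found'' 0 = (if eds G D \<and> sum \<omega> D \<noteq> \<infinity> then 1 else 0)"
    unfolding s4_def D_def using run_check[OF p3 G V] prep(3) by (simp_all add: f2 f3)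
  have Dv: "{v \<in> verts G. s4 ''D'' v = 1} = D" using chk(1) V by (auto simp: D_def)
  show ?thesis
  proof (cases "\<exists>D. eds G D \<and> sum \<omega> D \<noteq> \<infinity>")
    case True
    then obtain D0 where D0: "eds G D0" "sum \<omega> D0 \<noteq> \<infinity>" by blast
    interpret chordal_S123_free G by unfold_locales (use G free in auto)
    let ?B = "Suc (\<Sum>v<n. weight_code (\<omega> v))"
    \<comment> \<open>Only admissible vertices have a positive value, so the hole-freeness obtained
      from \<open>D0\<close> covers all vertices that the elimination considers.\<close>
    have "{y. y < n \<and> 0 < s1 ''W'' y} \<subseteq> admissible G"
      using prep(2) by (auto split: if_splits)
    then have hf: "hole_free (\<lambda>u v. u \<noteq> v \<and> near G u v) {y. y < n \<and> 0 < s1 ''W'' y}"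
      using square_hole_free[OF D0(1)] hole_free_mono by blast
    have z1: "s1 ''ns'' i = 0" "s1 ''ord'' i = 0" for i using prep(3) by simp_all
    obtain w where w: "w 0 = s1 ''W''" "\<And>y. y < n \<Longrightarrow> w n y = 0"
        "\<And>t. t < n \<Longrightarrow> elim_step G n (w t) (s2 ''ord'' t) (s2 ''delta'' t) (w (Suc t))"
      using run_elim[OF prep(1) V z1 hf] unfolding s2_def by metis
    have z2: "s2 ''cf'' i = 0" "s2 ''D'' i = 0" for i using prep(3) by (simp_all add: f2)
    have "max_packing (near G) (w 0) {..<n} D"
      unfolding D_def s3_def by (rule run_pick[OF p2 V z2 w(2,3)])
    then have mp: "max_packing (near G) (s1 ''W'') (verts G) D" using w(1) V by simp
    have "min_finite_eds G \<omega> D"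
    proof (rule max_packing_min_finite_eds[OF G D0 _ _ _ mp])
      have le: "cost_of (\<omega> v) \<le> weight_code (\<omega> v)" for v by (simp add: cost_of_def)
      then show sum: "(\<Sum>v\<in>verts G. cost_of (\<omega> v)) < ?B"
        unfolding V using sum_mono[of "{..<n}" "\<lambda>v. cost_of (\<omega> v)" "\<lambda>v. weight_code (\<omega> v)"] by simp
      show "s1 ''W'' v + cost_of (\<omega> v) = card (closed_nbhd G v) * ?B"
        if v: "v \<in> verts G" "v \<in> admissible G" "\<omega> v \<noteq> \<infinity>" for v
      proof -
        have "v \<in> closed_nbhd G v" "finite (closed_nbhd G v)" using v V by (auto simp: closed_nbhd_def)
        then have "1 \<le> card (closed_nbhd G v)" by (metis One_nat_def Suc_leI card_gt_0_iff empty_iff)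
        then have "?B \<le> card (closed_nbhd G v) * ?B"
          using mult_le_mono1[of 1 "card (closed_nbhd G v)" ?B] by (simp only: mult_1)
        moreover have "cost_of (\<omega> v) < ?B"
          using sum member_le_sum[of v "verts G" "\<lambda>v. cost_of (\<omega> v)"] v V by simp
        ultimately show ?thesis using prep(2)[of v] v V by simp
      qed
      show "s1 ''W'' v = 0" if "v \<in> verts G" "\<not> (v \<in> admissible G \<and> \<omega> v \<noteq> \<infinity>)" for v
      proof -
        have "v < n" using that(1) V by simp
        from prep(2)[OF this] that(2) show ?thesis by (simp only: if_False)
      qed
    qed
    then show ?thesis
      unfolding wed_answer_def run using True chk(2) Dv by (simp add: min_finite_eds_def)
  next
    case False
    then show ?thesis unfolding wed_answer_def run using chk(2) by auto
  qed
qed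

theorem theorem9: "WED_poly_time_on (\<lambda>G. induced_free S123 G \<and> chordal G)"
  unfolding WED_poly_time_on_def poly_time_solvable_def
proof (rule exI[of _ "code wed_prog"], rule exI[of _ "cost wed_prog"], rule ballI)
  fix x assume "x \<in> wed_instances (\<lambda>G. induced_free S123 G \<and> chordal G)"
  then obtain G \<omega> n where x: "x = (G, \<omega>)" and G: "simple_graph G" "verts G = {..<n}" "induced_free S123 G" "chordal G"
    by (auto simp: wed_instances_def)
  have n: "wed_input x ''n'' 0 = n" using G(2) by (simp add: x wed_input_def Let_def)
  obtain t where t: "exec (code wed_prog) (wed_input x) t (run wed_prog (wed_input x))" "t \<le> poly (cost wed_prog) n"
    using exec_code[OF wf_wed_prog, of "wed_input x"] unfolding n by blast
  \<comment> \<open>The time bound is a polynomial in \<open>n\<close>. The size contains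
    \<open>n * n\<close>, and polynomials with natural coefficients are monotone.\<close>
  have "n \<le> wed_size x"
    using G(2) by (simp add: x wed_size_def Let_def trans_le_add1)
  then have "t \<le> poly (cost wed_prog) (wed_size x)"
    using t(2) poly_nat_mono le_trans by blast
  moreover have "wed_answer x (run wed_prog (wed_input x))"
    unfolding x by (rule wed_prog_correct[OF G])
  ultimately show "\<exists>t s'. exec (code wed_prog) (wed_input x) t s' \<and> t \<le> poly (cost wed_prog) (wed_size x) \<and> wed_answer x s'"
    using t(1) by blast
qed

end
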